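(* Let $R$ be the ELT algebra with tangible values $F=(\mathbb{R},+)$ and layers $L=\mathbb{Q}$, and let $f\in R[\lambda_1,\dots,\lambda_n]$ be a regular polynomial which is primary at a point $a\in R^n$ with tangible coordinates. Then $f$ factors uniquely into irreducible factors (up to order and multiplication of the factors by constants).
   Context: ELT algebra: $R=\{{}^{[\ell]}\lambda : \lambda\in F,\ \ell\in L\}$, here with $F=(\mathbb{R},+)$ (usual order) and $L=\mathbb{Q}$, with operations: ${}^{[\ell_1]}\lambda+{}^{[\ell_2]}\lambda={}^{[\ell_1+\ell_2]}\lambda$; ${}^{[\ell_1]}\lambda_1+{}^{[\ell_2]}\lambda_2={}^{[\ell_1]}\lambda_1$ if $\lambda_1>\lambda_2$ (and symmetrically); ${}^{[\ell_1]}\lambda_1\cdot{}^{[\ell_2]}\lambda_2={}^{[\ell_1\ell_2]}(\lambda_1+_F\lambda_2)$. The layer is $s({}^{[\ell]}\lambda)=\ell$ and the tangible value is $t({}^{[\ell]}\lambda)=\lambda$. An element of layer $1$ is called tangible. A polynomial in $R[\lambda_1,\dots,\lambda_n]$ is a function $R^n\to R$ of the form $\sum_{I\in G}a_I\lambda^I$ with $G\subseteq(\mathbb{N}\cup\{0\})^n$ finite and $a_I\in R$; two polynomials are equal iff they are equal as functions. A monomial $h$ of an expression $f=\sum_i h_i$ is inessential if deleting it does not change the value of $f$ at any point; inessential monomials are deleted, and "the monomials of $f$" are the remaining ones. $f$ is regular if every (non-deleted) monomial of $f$ has a coefficient of nonzero layer. $f$ is primary at $a\in R^n$ if all monomials of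 $f$ have the same tangible value at $a$. A polynomial is irreducible if it is non-constant and is not a product of two non-constant polynomials. *)

theory Defs
  imports Complex_Main "HOL-Library.Multiset"
begin

text \<open>The ELT algebra with real tangible values and rational layers. There is no zero
  element (no \<open>-\<infinity>\<close> is adjoined): \<open>Elt l t\<close> with \<open>l = 0\<close> is an ordinary element.\<close>

datatype elt = Elt (layer: rat) (tval: real)

instantiation elt :: "{comm_semiring, comm_monoid_mult}"
begin

definition plus_elt :: "elt \<Rightarrow> elt \<Rightarrow> elt" where
  "x + y = (if tval x > tval y then x else if tval x < tval y then y
            else Elt (layer x + layer y) (tval x))"

definition times_elt :: "elt \<Rightarrow> elt \<Rightarrow> elt" where
  "x * y = Elt (layer x * layer y) (tval x + tval y)"

definition one_elt :: elt where
  "1 = Elt 1 0"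

instance
proof
  fix x y z :: elt
  show "x + y + z = x + (y + z)"
    by (cases x; cases y; cases z) (auto simp: plus_elt_def)
  show "x + y = y + x"
    by (cases x; cases y) (auto simp: plus_elt_def)
  show "x * y * z = x * (y * z)" "x * y = y * x" "1 * x = x"
    by (auto simp: times_elt_def one_elt_def)
  show "(x + y) * z = x * z + y * z"
    by (cases x; cases y; cases z) (auto simp: plus_elt_def times_elt_def algebra_simps)
qed

end

definition tangible :: "elt \<Rightarrow> bool" where
  "tangible x \<longleftrightarrow> layer x = 1"

text \<open>\<open>sum\<close> requires a zero, which the ELT algebra lacks. The following is the sum over a
  finite nonempty index set; \<open>None\<close> plays the role of the missing empty sum.\<close>

definition elt_sum :: "('i \<Rightarrow> elt) \<Rightarrow> 'i set \<Rightarrow> elt" where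
  "elt_sum h A =
     the (Finite_Set.fold (\<lambda>i s. Some (case s of None \<Rightarrow> h i | Some y \<Rightarrow> h i + y)) None A)"

lemma elt_sum_comp_fun_commute:
  "comp_fun_commute (\<lambda>i s. Some (case s of None \<Rightarrow> h i | Some y \<Rightarrow> h i + (y :: elt)))"
  by standard (auto simp: fun_eq_iff add_ac split: option.splits)

lemma elt_sum_singleton [simp]: "elt_sum h {i} = h i"
proof -
  interpret comp_fun_commute "\<lambda>i s. Some (case s of None \<Rightarrow> h i | Some y \<Rightarrow> h i + (y :: elt))"
    by (rule elt_sum_comp_fun_commute)
  show ?thesis by (simp add: elt_sum_def)
qed

lemma elt_sum_insert:
  assumes "finite A" "A \<noteq> {}" "i \<notin> A"
  shows "elt_sum h (insert i A) = h i + elt_sum h A"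
proof -
  let ?F = "\<lambda>i s. Some (case s of None \<Rightarrow> h i | Some y \<Rightarrow> h i + y)"
  interpret comp_fun_commute ?F by (rule elt_sum_comp_fun_commute)
  obtain j B where B: "A = insert j B" "j \<notin> B"
    using assms(2) by (metis Set.set_insert all_not_in_conv)
  then have "finite B" using assms(1) by simp
  then have "Finite_Set.fold ?F None A \<noteq> None" using B by simp
  then show ?thesis
    using assms by (auto simp: elt_sum_def)
qed

text \<open>An expression \<open>\<Sum>I\<in>G. c I \<lambda>\<^sup>I\<close> is given by its finite nonempty set \<open>G\<close> of exponents and its
  coefficients \<open>c\<close>, of which only the values on \<open>G\<close> matter. The variables are indexed by the
  finite type \<open>'n\<close>. Polynomials are functions.\<close>

definition elt_monom :: "elt \<Rightarrow> ('n::finite \<Rightarrow> nat) \<Rightarrow> ('n \<Rightarrow> elt) \<Rightarrow> elt" where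
  "elt_monom c I x = c * (\<Prod>i\<in>UNIV. x i ^ I i)"

definition elt_poly :: "('n::finite \<Rightarrow> nat) set \<Rightarrow> (('n \<Rightarrow> nat) \<Rightarrow> elt) \<Rightarrow> ('n \<Rightarrow> elt) \<Rightarrow> elt" where
  "elt_poly G c x = elt_sum (\<lambda>I. elt_monom (c I) I x) G"

definition is_elt_poly :: "(('n::finite \<Rightarrow> elt) \<Rightarrow> elt) \<Rightarrow> bool" where
  "is_elt_poly f \<longleftrightarrow> (\<exists>G c. finite G \<and> G \<noteq> {} \<and> f = elt_poly G c)"

text \<open>The only monomial of an expression cannot be deleted, there being no empty sum.\<close>

definition inessential ::
  "('n::finite \<Rightarrow> nat) set \<Rightarrow> (('n \<Rightarrow> nat) \<Rightarrow> elt) \<Rightarrow> ('n \<Rightarrow> nat) \<Rightarrow> bool" where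
  "inessential G c I \<longleftrightarrow> G - {I} \<noteq> {} \<and> (\<forall>x. elt_poly (G - {I}) c x = elt_poly G c x)"

definition monomials ::
  "('n::finite \<Rightarrow> nat) set \<Rightarrow> (('n \<Rightarrow> nat) \<Rightarrow> elt) \<Rightarrow> ('n \<Rightarrow> nat) set" where
  "monomials G c = {I \<in> G. \<not> inessential G c I}"

definition regular :: "('n::finite \<Rightarrow> nat) set \<Rightarrow> (('n \<Rightarrow> nat) \<Rightarrow> elt) \<Rightarrow> bool" where
  "regular G c \<longleftrightarrow> (\<forall>I \<in> monomials G c. layer (c I) \<noteq> 0)"

definition primary_at ::
  "('n::finite \<Rightarrow> nat) set \<Rightarrow> (('n \<Rightarrow> nat) \<Rightarrow> elt) \<Rightarrow> ('n \<Rightarrow> elt) \<Rightarrow> bool" where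
  "primary_at G c a \<longleftrightarrow>
     (\<forall>I \<in> monomials G c. \<forall>J \<in> monomials G c.
        tval (elt_monom (c I) I a) = tval (elt_monom (c J) J a))"

definition constant_fun :: "('a \<Rightarrow> elt) \<Rightarrow> bool" where
  "constant_fun f \<longleftrightarrow> (\<exists>k. \<forall>x. f x = k)"

definition elt_irreducible :: "(('n::finite \<Rightarrow> elt) \<Rightarrow> elt) \<Rightarrow> bool" where
  "elt_irreducible f \<longleftrightarrow> is_elt_poly f \<and> \<not> constant_fun f \<and>
     \<not> (\<exists>g h. is_elt_poly g \<and> is_elt_poly h \<and> \<not> constant_fun g \<and> \<not> constant_fun h \<and>
           (\<forall>x. f x = g x * h x))"

text \<open>The constant \<open>k\<close> allows for the empty factorization of a constant polynomial.\<close>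

definition irreducible_factorization ::
  "(('n::finite \<Rightarrow> elt) \<Rightarrow> elt) \<Rightarrow> elt \<Rightarrow> (('n \<Rightarrow> elt) \<Rightarrow> elt) multiset \<Rightarrow> bool" where
  "irreducible_factorization f k P \<longleftrightarrow>
     (\<forall>p \<in># P. elt_irreducible p) \<and> (\<forall>x. f x = k * (\<Prod>p \<in># P. p x))"

text \<open>Exactly the constants of nonzero layer are invertible; excluding the others makes this
  an equivalence relation.\<close>

definition equal_up_to_constant :: "('a \<Rightarrow> elt) \<Rightarrow> ('a \<Rightarrow> elt) \<Rightarrow> bool" where
  "equal_up_to_constant p q \<longleftrightarrow> (\<exists>k. layer k \<noteq> 0 \<and> (\<forall>x. p x = k * q x))"

definition factors_uniquely :: "(('n::finite \<Rightarrow> elt) \<Rightarrow> elt) \<Rightarrow> bool" where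
  "factors_uniquely f \<longleftrightarrow>
     (\<exists>k P. irreducible_factorization f k P) \<and>
     (\<forall>k P l Q. irreducible_factorization f k P \<longrightarrow> irreducible_factorization f l Q \<longrightarrow>
        rel_mset equal_up_to_constant P Q)"

end

theory Submission
  imports Defs "HOL-Computational_Algebra.Polynomial" "HOL-Analysis.Continuum_Not_Denumerable"
begin

text \<open>Up to a constant, a regular polynomial that is primary at a point \<open>a\<close> is determined by the
  layers \<open>l I\<close> of its monomials, i.e. by a nonzero polynomial over \<open>\<rat>\<close>, and pointwise
  multiplication of functions is multiplication of these polynomials: along each ray from \<open>a\<close> the
  monomials of greatest slope dominate, and initial forms are multiplicative. Every factor of such
  a function is again of this kind, because its tangible value is convex while that of the product
  is affine along rays from \<open>a\<close>. So irreducible ELT factors correspond to primes of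
  \<open>\<rat>[x\<^sub>1, \<dots>, x\<^sub>n]\<close>, and the theorem reduces to Gauss' theorem. The polynomial ring is realized as
  a subring \<open>\<rat>[\<theta>\<^sub>1, \<dots>, \<theta>\<^sub>n]\<close> of the reals, with algebraically independent \<open>\<theta>\<^sub>i\<close>.\<close>

section \<open>Factorial subrings of an integral domain\<close>

text \<open>Gauss' theorem is iterated one variable at a time, and each passage to
  \<open>'a poly\<close> changes the type. Evaluating at a new transcendental real returns to the
  type of reals, so the induction over variables can be stated there; this is why divisibility,
  units and primes are relative to a carrier set \<open>S\<close>. The rings stay countable, so a
  further transcendental real always exists. A monomial of layer 0 can dominate a sum, fixing its
  tangible value while adding nothing to its layer. Nonzero layers exclude this loss: in every
  direction the layer of the value is then a nonzero rational polynomial in the layers of the point,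
  determined by its values at rational points. The factors in a given factorization are assumed
  neither regular nor primary. Convexity controls their tangible values; their layers are controlled
  by the initial forms of the product, which do not vanish identically. The ring records layers
  only. Its units are the nonzero rationals, which are the layers of the invertible constants; the
  tangible value of a constant is carried separately, as the parameter \<open>b\<close> of a
  symbol.\<close>

definition is_subring :: "'a::idom set \<Rightarrow> bool" where
  "is_subring S \<longleftrightarrow> 0 \<in> S \<and> 1 \<in> S \<and>
     (\<forall>a\<in>S. \<forall>b\<in>S. a + b \<in> S) \<and> (\<forall>a\<in>S. \<forall>b\<in>S. a * b \<in> S) \<and> (\<forall>a\<in>S. - a \<in> S)"

definition dvd_in :: "'a::idom set \<Rightarrow> 'a \<Rightarrow> 'a \<Rightarrow> bool" where
  "dvd_in S a b \<longleftrightarrow> (\<exists>c\<in>S. b = a * c)"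

definition unit_in :: "'a::idom set \<Rightarrow> 'a \<Rightarrow> bool" where
  "unit_in S u \<longleftrightarrow> u \<in> S \<and> dvd_in S u 1"

definition prime_in :: "'a::idom set \<Rightarrow> 'a \<Rightarrow> bool" where
  "prime_in S p \<longleftrightarrow> p \<in> S \<and> p \<noteq> 0 \<and> \<not> unit_in S p \<and>
     (\<forall>a\<in>S. \<forall>b\<in>S. dvd_in S p (a * b) \<longrightarrow> dvd_in S p a \<or> dvd_in S p b)"

inductive prime_product :: "'a::idom set \<Rightarrow> 'a \<Rightarrow> bool" for S where
  unit: "unit_in S u \<Longrightarrow> prime_product S u"
| prime: "prime_in S q \<Longrightarrow> prime_product S a \<Longrightarrow> prime_product S (q * a)"

text \<open>Asking for products of primes, not of irreducible elements, makes uniqueness automatic.\<close>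

definition factorial_subring :: "'a::idom set \<Rightarrow> bool" where
  "factorial_subring S \<longleftrightarrow> is_subring S \<and> (\<forall>a\<in>S. a \<noteq> 0 \<longrightarrow> prime_product S a)"

lemma is_subringD:
  assumes "is_subring S"
  shows "0 \<in> S" "1 \<in> S" "a \<in> S \<Longrightarrow> b \<in> S \<Longrightarrow> a + b \<in> S"
    "a \<in> S \<Longrightarrow> b \<in> S \<Longrightarrow> a * b \<in> S" "a \<in> S \<Longrightarrow> - a \<in> S"
    "a \<in> S \<Longrightarrow> b \<in> S \<Longrightarrow> a - b \<in> S" "a \<in> S \<Longrightarrow> a ^ n \<in> S"
proof -
  have d: "a - b = a + - b" for a b :: 'a by simp
  show "a \<in> S \<Longrightarrow> b \<in> S \<Longrightarrow> a - b \<in> S"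
    using assms unfolding is_subring_def d by blast
  show "a \<in> S \<Longrightarrow> a ^ n \<in> S"
    using assms by (induction n) (auto simp: is_subring_def)
qed (use assms in \<open>auto simp: is_subring_def\<close>)

lemma is_subring_sum:
  assumes "is_subring S" "\<And>i. i \<in> A \<Longrightarrow> f i \<in> S"
  shows "sum f A \<in> S"
  using assms(2)
  by (induction A rule: infinite_finite_induct) (auto simp: is_subringD[OF assms(1)])

lemma is_subring_prod_mset:
  assumes "is_subring S" "\<And>u. u \<in># M \<Longrightarrow> u \<in> S"
  shows "prod_mset M \<in> S"
  using assms(2) by (induction M) (auto simp: is_subringD[OF assms(1)])

lemma dvd_in_mult: "is_subring S \<Longrightarrow> dvd_in S a b \<Longrightarrow> c \<in> S \<Longrightarrow> dvd_in S a (b * c)"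
  unfolding dvd_in_def by (metis is_subringD(4) mult.assoc)

lemma dvd_in_mult2: "is_subring S \<Longrightarrow> dvd_in S a b \<Longrightarrow> c \<in> S \<Longrightarrow> dvd_in S a (c * b)"
  using dvd_in_mult by (metis mult.commute)

lemma dvd_in_trans: "is_subring S \<Longrightarrow> dvd_in S a b \<Longrightarrow> dvd_in S b c \<Longrightarrow> dvd_in S a c"
  unfolding dvd_in_def by (metis is_subringD(4) mult.assoc)

lemma dvd_in_add: "is_subring S \<Longrightarrow> dvd_in S a b \<Longrightarrow> dvd_in S a c \<Longrightarrow> dvd_in S a (b + c)"
  unfolding dvd_in_def by (metis is_subringD(3) distrib_left)

lemma dvd_in_diff: "is_subring S \<Longrightarrow> dvd_in S a b \<Longrightarrow> dvd_in S a c \<Longrightarrow> dvd_in S a (b - c)"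
  unfolding dvd_in_def by (metis is_subringD(6) right_diff_distrib)

lemma dvd_in_0: "is_subring S \<Longrightarrow> dvd_in S a 0"
  unfolding dvd_in_def by (metis is_subringD(1) mult_zero_right)

lemma dvd_in_sum:
  assumes "is_subring S" "\<And>i. i \<in> A \<Longrightarrow> dvd_in S a (f i)"
  shows "dvd_in S a (sum f A)"
  using assms(2)
  by (induction A rule: infinite_finite_induct) (auto simp: dvd_in_0 dvd_in_add assms(1))

lemma unit_in_inverse:
  assumes "unit_in S u"
  obtains v where "unit_in S v" "u * v = 1"
proof -
  obtain v where v: "v \<in> S" "1 = u * v" "u \<in> S"
    using assms by (auto simp: unit_in_def dvd_in_def)
  then have "unit_in S v" unfolding unit_in_def dvd_in_def by (metis mult.commute)
  with v that show thesis by simp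
qed

lemma unit_in_mult: "is_subring S \<Longrightarrow> unit_in S u \<Longrightarrow> unit_in S v \<Longrightarrow> unit_in S (u * v)"
proof -
  assume S: "is_subring S" and u: "unit_in S u" and v: "unit_in S v"
  obtain u' where u': "unit_in S u'" "u * u' = 1" using unit_in_inverse[OF u] .
  obtain v' where v': "unit_in S v'" "v * v' = 1" using unit_in_inverse[OF v] .
  have "1 = (u * v) * (u' * v')"
    using u'(2) v'(2) by (metis mult.assoc mult.commute mult_1_left)
  moreover have "u' * v' \<in> S" "u * v \<in> S"
    using u u' v v' S by (auto simp: unit_in_def is_subringD)
  ultimately show ?thesis unfolding unit_in_def dvd_in_def by blast
qed

lemma unit_in_factor:
  assumes "is_subring S" "unit_in S (u * v)" "u \<in> S" "v \<in> S"
  shows "unit_in S u"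
proof -
  obtain w where "w \<in> S" "1 = u * v * w" using assms(2) by (auto simp: unit_in_def dvd_in_def)
  then have "1 = u * (v * w)" "v * w \<in> S" using assms by (auto simp: is_subringD mult.assoc)
  then show ?thesis using assms(3) unfolding unit_in_def dvd_in_def by blast
qed

lemma prime_inD:
  assumes "prime_in S p"
  shows "p \<in> S" "p \<noteq> 0" "\<not> unit_in S p"
    "a \<in> S \<Longrightarrow> b \<in> S \<Longrightarrow> dvd_in S p (a * b) \<Longrightarrow> dvd_in S p a \<or> dvd_in S p b"
  using assms by (auto simp: prime_in_def)

lemma prime_in_not_dvd_1: "prime_in S p \<Longrightarrow> \<not> dvd_in S p 1"
  by (auto simp: prime_in_def unit_in_def)

lemma prime_in_unit_mult:
  assumes S: "is_subring S" and p: "prime_in S p" and u: "unit_in S u"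
  shows "prime_in S (u * p)"
proof -
  obtain v where v: "unit_in S v" "u * v = 1" using unit_in_inverse[OF u] .
  have vS: "v \<in> S" "u \<in> S" using u v by (auto simp: unit_in_def)
  have p': "p = (u * p) * v" using v(2) by (metis mult.commute mult.left_commute mult_1_right)
  have d1: "dvd_in S (u * p) p" unfolding dvd_in_def using p' vS(1) by blast
  have d2: "dvd_in S p (u * p)" unfolding dvd_in_def using vS(2) by (metis mult.commute)
  have "u \<noteq> 0" using v(2) by auto
  then show ?thesis unfolding prime_in_def
  proof (intro conjI ballI impI)
    show "u * p \<in> S" using p vS S by (simp add: is_subringD prime_inD)
    show "\<not> unit_in S (u * p)"
      using unit_in_factor[of S p u] S p vS prime_inD by (metis mult.commute)
    fix a b assume ab: "a \<in> S" "b \<in> S" "dvd_in S (u * p) (a * b)"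
    then have "dvd_in S p (a * b)" using dvd_in_trans[OF S d2] by blast
    then have "dvd_in S p a \<or> dvd_in S p b" using prime_inD(4)[OF p] ab by blast
    then show "dvd_in S (u * p) a \<or> dvd_in S (u * p) b" using dvd_in_trans[OF S d1] by blast
  qed (use p in \<open>auto simp: prime_in_def\<close>)
qed

lemma prime_product_in:
  assumes "is_subring S" "prime_product S a" shows "a \<in> S"
  using assms(2)
  by (induction rule: prime_product.induct) (auto simp: unit_in_def prime_inD is_subringD assms(1))

lemma prime_product_unit:
  assumes "is_subring S" "prime_product S a" "\<And>q. prime_in S q \<Longrightarrow> \<not> dvd_in S q a"
  shows "unit_in S a"
  using assms(2)
proof cases
  case (prime q b)
  have "b \<in> S" using prime_product_in[OF assms(1) prime(3)] .
  then have "dvd_in S q a" using prime by (auto simp: dvd_in_def)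
  then show ?thesis using assms(3) prime by blast
qed

lemma prime_product_nonzero: "prime_product S a \<Longrightarrow> a \<noteq> 0"
  by (induction rule: prime_product.induct) (auto simp: unit_in_def prime_inD dvd_in_def)

lemma prime_product_mult:
  assumes S: "is_subring S" and a: "prime_product S a" and b: "prime_product S b"
  shows "prime_product S (a * b)"
  using a
proof (induction rule: prime_product.induct)
  case (unit u)
  from b unit show ?case
  proof (induction arbitrary: u rule: prime_product.induct)
    case (unit v)
    then show ?case using S by (intro prime_product.unit) (auto intro: unit_in_mult)
  next
    case (prime q c)
    then show ?case using prime_product.prime[of S q "u * c"] by (simp add: mult.left_commute)
  qed
next
  case (prime q c)
  then show ?case using prime_product.prime[of S q "c * b"] by (simp add: mult_ac)
qed

lemma prime_product_mset:
  assumes "prime_product S a"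
  obtains e M where "unit_in S e" "\<And>q. q \<in># M \<Longrightarrow> prime_in S q" "a = e * prod_mset M"
  using assms
proof (induction arbitrary: thesis rule: prime_product.induct)
  case (unit u)
  then show ?case using unit(2)[of u "{#}"] by auto
next
  case (prime q b)
  obtain e M where "unit_in S e" "\<And>q. q \<in># M \<Longrightarrow> prime_in S q" "b = e * prod_mset M"
    using prime.IH by blast
  then show ?case using prime(1) prime.prems[of e "add_mset q M"] by (auto simp: mult_ac)
qed

lemma prime_in_dvd_prod_mset:
  assumes "is_subring S" "prime_in S q" "\<And>u. u \<in># M \<Longrightarrow> u \<in> S" "dvd_in S q (prod_mset M)"
  shows "\<exists>u. u \<in># M \<and> dvd_in S q u"
  using assms(3,4)
proof (induction M)
  case empty
  then show ?case using prime_in_not_dvd_1[OF assms(2)] by simp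
next
  case (add u M)
  have "prod_mset M \<in> S" using add.prems by (intro is_subring_prod_mset[OF assms(1)]) auto
  then have "dvd_in S q u \<or> dvd_in S q (prod_mset M)"
    using prime_inD(4)[OF assms(2)] add.prems by auto
  then show ?case using add by auto
qed

text \<open>With \<open>q = p * c\<close>, primality of \<open>q\<close> gives two cases: if
  \<open>q\<close> divides \<open>p\<close>, cancelling makes \<open>c\<close> a unit; if
  \<open>q\<close> divides \<open>c\<close>, cancelling would make \<open>p\<close> a unit.\<close>

lemma prime_in_dvd_prime:
  assumes "is_subring S" "prime_in S p" "prime_in S q" "dvd_in S p q"
  shows "\<exists>e. unit_in S e \<and> q = e * p"
proof -
  obtain c where c: "c \<in> S" "q = p * c" using assms(4) by (auto simp: dvd_in_def)
  have "dvd_in S q (p * c)" unfolding dvd_in_def c(2) using is_subringD(2)[OF assms(1)] by force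
  then have "dvd_in S q p \<or> dvd_in S q c" using prime_inD[OF assms(3)] prime_inD[OF assms(2)] c by blast
  then show ?thesis
  proof
    assume "dvd_in S q p"
    then obtain d where d: "d \<in> S" "p = q * d" by (auto simp: dvd_in_def)
    then have "p * 1 = p * (c * d)" using c by (simp add: mult_ac)
    then have "1 = c * d" using prime_inD(2)[OF assms(2)] mult_cancel_left by blast
    then have "unit_in S c" unfolding unit_in_def dvd_in_def using c d by blast
    then show ?thesis using c by (auto simp: mult_ac)
  next
    assume "dvd_in S q c"
    then obtain d where d: "d \<in> S" "c = q * d" by (auto simp: dvd_in_def)
    then have "q * 1 = q * (p * d)" using c by (metis mult.left_commute mult_1_right)
    then have "1 = p * d" using prime_inD(2)[OF assms(3)] mult_cancel_left by blast
    then have "unit_in S p" unfolding unit_in_def dvd_in_def using prime_inD[OF assms(2)] d by blast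
    then show ?thesis using prime_inD[OF assms(2)] by blast
  qed
qed

text \<open>Each \<open>p\<close> in \<open>P\<close> divides, hence is associated to, some
  \<open>q\<close> in \<open>Q\<close>, and both are cancelled. The units \<open>e\<close> and
  \<open>e'\<close> are arbitrary so that the unit left by a cancellation can be absorbed into
  \<open>e'\<close>.\<close>

lemma unique_prime_factorization:
  assumes S: "is_subring S"
    and "unit_in S e" "unit_in S e'" "e * prod_mset P = e' * prod_mset Q"
    and "\<And>p. p \<in># P \<Longrightarrow> prime_in S p" "\<And>q. q \<in># Q \<Longrightarrow> prime_in S q"
  shows "rel_mset (\<lambda>p q. \<exists>e. unit_in S e \<and> p = e * q) P Q"
  using assms(2-)
proof (induction P arbitrary: e e' Q)
  case empty
  have "Q = {#}"
  proof (rule ccontr)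
    assume "Q \<noteq> {#}"
    then obtain q Q' where q: "Q = add_mset q Q'" by (meson multiset_cases)
    obtain d where d: "unit_in S d" "e * d = 1" using unit_in_inverse[OF empty(1)] .
    have "prod_mset Q' \<in> S"
      using empty.prems(5) q by (intro is_subring_prod_mset[OF S]) (auto intro: prime_inD)
    then have "e' * prod_mset Q' * d \<in> S"
      using empty.prems(2) d S by (auto simp: unit_in_def is_subringD)
    moreover have "1 = q * (e' * prod_mset Q' * d)"
      using empty.prems(3) d(2) q by (simp add: mult_ac)
    ultimately have "dvd_in S q 1" unfolding dvd_in_def by blast
    then show False using prime_in_not_dvd_1 empty.prems(5) q by auto
  qed
  then show ?case by (simp add: rel_mset_Zero)
next
  case (add p P)
  have p: "prime_in S p" using add.prems by auto
  have PS: "prod_mset P \<in> S"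
    using add.prems by (intro is_subring_prod_mset[OF S]) (auto intro: prime_inD)
  have "dvd_in S p (e' * prod_mset Q)"
    unfolding dvd_in_def add.prems(3)[symmetric]
    by (rule bexI[of _ "e * prod_mset P"])
      (use add.prems(1) PS S in \<open>auto simp: mult_ac unit_in_def is_subringD\<close>)
  moreover have QS: "prod_mset Q \<in> S"
    using add.prems by (intro is_subring_prod_mset[OF S]) (auto intro: prime_inD)
  ultimately have "dvd_in S p e' \<or> dvd_in S p (prod_mset Q)"
    using prime_inD(4)[OF p] add.prems(2) by (auto simp: unit_in_def)
  moreover have "\<not> dvd_in S p e'"
    using dvd_in_trans[OF S] prime_in_not_dvd_1[OF p] add.prems(2) by (auto simp: unit_in_def)
  ultimately obtain q where q: "q \<in># Q" "dvd_in S p q"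
    using prime_in_dvd_prod_mset[OF S p, of Q] add.prems(5) prime_inD(1) by blast
  then obtain d where d: "unit_in S d" "q = d * p"
    using prime_in_dvd_prime[OF S p _ q(2)] add.prems(5) by blast
  obtain d' where d': "unit_in S d'" "d * d' = 1" using unit_in_inverse[OF d(1)] .
  have pq: "p = d' * q" unfolding d(2) using d'(2) by (metis mult.assoc mult.commute mult_1_left)
  define Q' where "Q' = Q - {#q#}"
  have Q: "Q = add_mset q Q'" using q(1) by (simp add: Q'_def)
  have "p * (e * prod_mset P) = p * ((e' * d) * prod_mset Q')"
    using add.prems(3) d(2) by (simp add: Q mult_ac)
  then have "e * prod_mset P = (e' * d) * prod_mset Q'" using prime_inD(2)[OF p] by simp
  then have "rel_mset (\<lambda>p q. \<exists>e. unit_in S e \<and> p = e * q) P Q'"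
    using add.prems unit_in_mult[OF S add.prems(2) d(1)] Q by (intro add.IH) auto
  then show ?case unfolding Q using d'(1) pq by (intro rel_mset_Plus) auto
qed

text \<open>Injectivity is asked on \<open>A\<close> only: the intended \<open>\<phi>\<close> is
  evaluation of real polynomials at a real number, which is injective just on polynomials over a
  ring where that number is transcendental. There divisibility is preserved in both directions, and
  with it units and primes.\<close>

lemma factorial_subring_image:
  assumes A: "factorial_subring A" and inj: "inj_on \<phi> A"
    and add: "\<And>a b. \<phi> (a + b) = \<phi> a + \<phi> b" and mult: "\<And>a b. \<phi> (a * b) = \<phi> a * \<phi> b"
    and one: "\<phi> 1 = 1"
  shows "factorial_subring (\<phi> ` A)"
proof -
  have S: "is_subring A" using A by (simp add: factorial_subring_def)
  have zero: "\<phi> 0 = 0" using add[of 0 0] by (metis add_0 add_cancel_left_left)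
  have minus: "\<phi> (- a) = - \<phi> a" for a
    using add[of a "- a"] zero by (simp add: eq_neg_iff_add_eq_0 add.commute)
  have S': "is_subring (\<phi> ` A)"
    unfolding is_subring_def
  proof (intro conjI ballI)
    show "0 \<in> \<phi> ` A" "1 \<in> \<phi> ` A"
      using is_subringD(1,2)[OF S] zero one by (metis imageI)+
    fix x assume "x \<in> \<phi> ` A"
    then obtain a where a: "a \<in> A" "x = \<phi> a" by blast
    then show "- x \<in> \<phi> ` A" using is_subringD(5)[OF S a(1)] by (metis imageI minus)
    fix y assume "y \<in> \<phi> ` A"
    then obtain b where b: "b \<in> A" "y = \<phi> b" by blast
    show "x + y \<in> \<phi> ` A" "x * y \<in> \<phi> ` A"
      using is_subringD(3,4)[OF S a(1) b(1)] a(2) b(2) by (metis imageI add mult)+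
  qed
  have dvd: "dvd_in (\<phi> ` A) (\<phi> a) (\<phi> b) \<longleftrightarrow> dvd_in A a b" if "a \<in> A" "b \<in> A" for a b
  proof -
    have "\<phi> b = \<phi> a * \<phi> c \<longleftrightarrow> b = a * c" if "c \<in> A" for c
      unfolding mult[symmetric] using inj_on_eq_iff[OF inj \<open>b \<in> A\<close>] is_subringD(4)[OF S \<open>a \<in> A\<close> that]
      by blast
    then show ?thesis by (auto simp: dvd_in_def)
  qed
  have unit_img: "unit_in (\<phi> ` A) (\<phi> a) \<longleftrightarrow> unit_in A a" if "a \<in> A" for a
    unfolding unit_in_def using that dvd[of a 1] is_subringD(2)[OF S] one by auto
  have prime_img: "prime_in (\<phi> ` A) (\<phi> p)" if p: "prime_in A p" for p
    unfolding prime_in_def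
  proof (intro conjI ballI impI)
    have pA: "p \<in> A" using prime_inD[OF p] by simp
    show "\<phi> p \<in> \<phi> ` A" using pA by simp
    show "\<phi> p \<noteq> 0"
      using inj_onD[OF inj, of p 0] prime_inD[OF p] zero is_subringD(1)[OF S] by auto
    show "\<not> unit_in (\<phi> ` A) (\<phi> p)" using unit_img[OF pA] prime_inD[OF p] by simp
    fix x y assume "x \<in> \<phi> ` A" "y \<in> \<phi> ` A" "dvd_in (\<phi> ` A) (\<phi> p) (x * y)"
    then obtain a b where ab: "a \<in> A" "b \<in> A" "x = \<phi> a" "y = \<phi> b"
      "dvd_in (\<phi> ` A) (\<phi> p) (\<phi> (a * b))" by (auto simp: mult)
    then have "dvd_in A p (a * b)" using dvd[OF pA] is_subringD(4)[OF S] by blast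
    then have "dvd_in A p a \<or> dvd_in A p b" using prime_inD(4)[OF p] ab by blast
    then show "dvd_in (\<phi> ` A) (\<phi> p) x \<or> dvd_in (\<phi> ` A) (\<phi> p) y"
      using dvd[OF pA] ab by simp
  qed
  have "prime_product (\<phi> ` A) (\<phi> a)" if "prime_product A a" for a
    using that
  proof (induction rule: prime_product.induct)
    case (unit u)
    then show ?case using unit_img by (intro prime_product.unit) (auto simp: unit_in_def)
  next
    case (prime q b)
    then show ?case unfolding mult by (intro prime_product.prime) (use prime_img in auto)
  qed
  then show ?thesis
    using A S' zero by (auto simp: factorial_subring_def)
qed

section \<open>Gauss: polynomials over a factorial subring\<close>

definition polys_over :: "'a::idom set \<Rightarrow> 'a poly set" where
  "polys_over S = {p. \<forall>k. coeff p k \<in> S}"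

lemma is_subring_polys_over:
  assumes "is_subring S" shows "is_subring (polys_over S)"
  unfolding is_subring_def polys_over_def
  by (auto simp: is_subringD[OF assms] coeff_mult coeff_1 if_distrib cong: if_cong
      intro!: is_subring_sum[OF assms])

lemma const_in_polys_over: "is_subring S \<Longrightarrow> [:a:] \<in> polys_over S \<longleftrightarrow> a \<in> S"
  unfolding polys_over_def
  by (auto simp: coeff_pCons is_subringD split: nat.splits dest: spec[of _ 0])

lemma monom_in_polys_over: "is_subring S \<Longrightarrow> a \<in> S \<Longrightarrow> monom a k \<in> polys_over S"
  unfolding polys_over_def by (auto simp: is_subringD)

lemma const_dvd_in_iff:
  assumes S: "is_subring S" and q: "q \<noteq> 0"
  shows "dvd_in (polys_over S) [:q:] f \<longleftrightarrow> (\<forall>k. dvd_in S q (coeff f k))"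
proof
  assume "dvd_in (polys_over S) [:q:] f"
  then show "\<forall>k. dvd_in S q (coeff f k)" by (auto simp: dvd_in_def polys_over_def)
next
  assume "\<forall>k. dvd_in S q (coeff f k)"
  then obtain e where e: "\<And>k. e k \<in> S" "\<And>k. coeff f k = q * e k"
    unfolding dvd_in_def by metis
  define g where "g = (\<Sum>k\<le>degree f. monom (e k) k)"
  have "g \<in> polys_over S" unfolding g_def
    using e is_subring_polys_over[OF S] by (intro is_subring_sum) (auto intro: monom_in_polys_over S)
  moreover have "f = [:q:] * g"
  proof (rule poly_eqI)
    fix k
    have "coeff g k = (if k \<le> degree f then e k else 0)" by (simp add: g_def coeff_sum)
    then show "coeff f k = coeff ([:q:] * g) k" using e(2)[of k] by (auto simp: coeff_eq_0)
  qed
  ultimately show "dvd_in (polys_over S) [:q:] f" by (auto simp: dvd_in_def)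
qed

text \<open>Gauss' lemma. If \<open>q\<close> divides neither factor, let \<open>i\<close> and
  \<open>j\<close> be the first indices of coefficients not divisible by \<open>q\<close>; in the
  coefficient of \<open>f * g\<close> at \<open>i + j\<close>, all terms but one are divisible by
  \<open>q\<close>.\<close>

lemma prime_in_const:
  assumes S: "is_subring S" and q: "prime_in S q"
  shows "prime_in (polys_over S) [:q:]"
  unfolding prime_in_def
proof (intro conjI ballI impI)
  have q0: "q \<noteq> 0" using q prime_inD by blast
  note D = const_dvd_in_iff[OF S q0]
  show "[:q:] \<in> polys_over S" using q prime_inD const_in_polys_over S by blast
  show "[:q:] \<noteq> 0" using q0 by simp
  show "\<not> unit_in (polys_over S) [:q:]"
    using prime_in_not_dvd_1[OF q] D[of 1] by (auto simp: unit_in_def dest: spec[of _ 0])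
  fix f g assume fg: "f \<in> polys_over S" "g \<in> polys_over S"
    and "dvd_in (polys_over S) [:q:] (f * g)"
  then have d: "dvd_in S q (coeff (f * g) k)" for k using D by blast
  show "dvd_in (polys_over S) [:q:] f \<or> dvd_in (polys_over S) [:q:] g"
  proof (rule ccontr)
    assume "\<not> ?thesis"
    then have ex: "\<exists>i. \<not> dvd_in S q (coeff f i)" "\<exists>j. \<not> dvd_in S q (coeff g j)" using D by auto
    define i where "i = (LEAST i. \<not> dvd_in S q (coeff f i))"
    define j where "j = (LEAST j. \<not> dvd_in S q (coeff g j))"
    have i: "\<not> dvd_in S q (coeff f i)" "\<And>k. k < i \<Longrightarrow> dvd_in S q (coeff f k)"
      using LeastI_ex[OF ex(1)] not_less_Least unfolding i_def by blast+
    have j: "\<not> dvd_in S q (coeff g j)" "\<And>k. k < j \<Longrightarrow> dvd_in S q (coeff g k)"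
      using LeastI_ex[OF ex(2)] not_less_Least unfolding j_def by blast+
    have cS: "coeff f k \<in> S" "coeff g k \<in> S" for k using fg by (auto simp: polys_over_def)
    have "dvd_in S q (\<Sum>k\<in>{..i+j} - {i}. coeff f k * coeff g (i + j - k))"
    proof (rule dvd_in_sum[OF S])
      fix k assume "k \<in> {..i+j} - {i}"
      then have "k < i \<or> i + j - k < j" by auto
      then show "dvd_in S q (coeff f k * coeff g (i + j - k))"
        using i(2) j(2) cS dvd_in_mult dvd_in_mult2 S by blast
    qed
    moreover have "coeff (f * g) (i + j) = coeff f i * coeff g j +
        (\<Sum>k\<in>{..i+j} - {i}. coeff f k * coeff g (i + j - k))"
      unfolding coeff_mult by (subst sum.remove[of _ i]) auto
    ultimately have "dvd_in S q (coeff f i * coeff g j)"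
      using dvd_in_diff[OF S d[of "i + j"]] by fastforce
    then show False using prime_inD(4)[OF q] cS i(1) j(1) by blast
  qed
qed

lemma unit_in_polys_over_iff:
  assumes S: "is_subring S"
  shows "unit_in (polys_over S) f \<longleftrightarrow> (\<exists>a. unit_in S a \<and> f = [:a:])"
proof
  assume "unit_in (polys_over S) f"
  then obtain g where fg: "f \<in> polys_over S" "g \<in> polys_over S" "1 = f * g"
    by (auto simp: unit_in_def dvd_in_def)
  then have "f \<noteq> 0" "g \<noteq> 0" by auto
  then have "degree f + degree g = 0" using fg(3) degree_mult_eq[of f g] by simp
  then have "degree f = 0" "degree g = 0" by auto
  then obtain a b where ab: "f = [:a:]" "g = [:b:]" using degree_eq_zeroE by metis
  then have "1 = a * b" using fg(3) by (simp add: one_pCons mult.commute)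
  then show "\<exists>a. unit_in S a \<and> f = [:a:]"
    using ab fg const_in_polys_over[OF S] by (auto simp: unit_in_def dvd_in_def)
next
  assume "\<exists>a. unit_in S a \<and> f = [:a:]"
  then obtain a b where ab: "a \<in> S" "b \<in> S" "1 = a * b" "f = [:a:]"
    by (auto simp: unit_in_def dvd_in_def)
  then have "1 = f * [:b:]" by (auto simp: one_pCons mult.commute)
  then show "unit_in (polys_over S) f"
    using ab const_in_polys_over[OF S] unfolding unit_in_def dvd_in_def by blast
qed

lemma prime_product_const:
  assumes S: "is_subring S" and a: "prime_product S a"
  shows "prime_product (polys_over S) [:a:]"
  using a
proof (induction rule: prime_product.induct)
  case (unit u)
  then show ?case using unit_in_polys_over_iff[OF S] by (intro prime_product.unit) auto
next
  case (prime q b)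
  then show ?case
    using prime_product.prime[OF prime_in_const[OF S prime(1)] prime.IH] by (simp add: mult.commute)
qed

text \<open>The primes of \<open>s\<close> are removed one at a time. Each stays prime among the
  polynomials and does not divide \<open>f\<close>, so it divides the cofactor and cancels.\<close>

lemma dvd_in_cancel_const:
  assumes S: "is_subring S" and s: "prime_product S s"
    and f: "f \<in> polys_over S" "\<And>q. prime_in S q \<Longrightarrow> \<not> dvd_in (polys_over S) [:q:] f"
    and g: "g \<in> polys_over S" "dvd_in (polys_over S) f ([:s:] * g)"
  shows "dvd_in (polys_over S) f g"
  using s g(2)
proof (induction rule: prime_product.induct)
  note PS = is_subring_polys_over[OF S]
  case (unit u)
  obtain v where v: "unit_in S v" "u * v = 1" using unit_in_inverse[OF unit(1)] .
  have "dvd_in (polys_over S) f ([:v:] * ([:u:] * g))"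
    using v(1) const_in_polys_over[OF S]
    by (intro dvd_in_mult2[OF PS unit(2)]) (auto simp: unit_in_def)
  moreover have "[:v:] * ([:u:] * g) = g" using v(2) by (simp add: mult.commute)
  ultimately show ?case by simp
next
  note PS = is_subring_polys_over[OF S]
  case (prime q s)
  then obtain w where w: "w \<in> polys_over S" "[:q * s:] * g = f * w" by (auto simp: dvd_in_def)
  have q: "q \<noteq> 0" "prime_in (polys_over S) [:q:]"
    using prime(1) prime_inD prime_in_const S by blast+
  have sg: "[:s:] * g \<in> polys_over S"
    using prime_product_in[OF S prime(2)] g(1) by (auto intro!: is_subringD(4)[OF PS] simp: const_in_polys_over S simp del: mult_pCons_left)
  have e: "[:q * s:] * g = [:q:] * ([:s:] * g)" by (simp add: mult_ac)
  then have "dvd_in (polys_over S) [:q:] (f * w)"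
    using sg w(2) unfolding dvd_in_def by metis
  then have "dvd_in (polys_over S) [:q:] w" using f prime(1) prime_inD(4)[OF q(2)] w(1) by blast
  then obtain w' where w': "w' \<in> polys_over S" "w = [:q:] * w'" by (auto simp: dvd_in_def)
  have "[:q:] * ([:s:] * g) = [:q:] * (f * w')" using e w(2) w'(2) by (metis mult.left_commute)
  then have "[:s:] * g = f * w'" using q(1) by (simp only: mult_cancel_left) auto
  then have "dvd_in (polys_over S) f ([:s:] * g)" using w'(1) by (auto simp: dvd_in_def)
  then show ?case by (rule prime.IH)
qed

text \<open>Each prime of \<open>s\<close> is divided out of \<open>d\<close> or of
  \<open>e\<close>, whichever it divides. Only the constant taken from \<open>d\<close> is recorded,
  because \<open>d\<close> is later to be recovered from \<open>d'\<close>.\<close>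

lemma factor_const_split:
  assumes S: "is_subring S" and s: "prime_product S s"
    and "f \<in> polys_over S" "d \<in> polys_over S" "e \<in> polys_over S" "[:s:] * f = d * e"
  shows "\<exists>d'\<in>polys_over S. \<exists>e'\<in>polys_over S. \<exists>s'\<in>S. f = d' * e' \<and> d = [:s':] * d'"
  using s assms(4-)
proof (induction arbitrary: d e rule: prime_product.induct)
  note PS = is_subring_polys_over[OF S]
  case (unit u)
  obtain v where v: "unit_in S v" "u * v = 1" using unit_in_inverse[OF unit(1)] .
  have "f = [:v:] * ([:u:] * f)" using v(2) by (simp add: mult_ac)
  also have "\<dots> = ([:v:] * d) * e" using unit by (simp only: mult.assoc)
  finally have "f = ([:v:] * d) * e" .
  moreover have "[:v:] * d \<in> polys_over S"
    using v unit const_in_polys_over[OF S] by (intro is_subringD(4)[OF PS]) (auto simp: unit_in_def)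
  moreover have "d = [:u:] * ([:v:] * d)" using v(2) by (simp add: mult_ac)
  ultimately show ?case using unit unfolding unit_in_def by blast
next
  note PS = is_subring_polys_over[OF S]
  case (prime q s)
  have q: "[:q:] \<noteq> 0" "prime_in (polys_over S) [:q:]" "q \<in> S"
    using prime(1) prime_inD[OF prime(1)] prime_in_const S by auto
  have sf: "[:s:] * f \<in> polys_over S"
    using prime_product_in[OF S prime(2)] assms(3) by (auto intro!: is_subringD(4)[OF PS] simp: const_in_polys_over S simp del: mult_pCons_left)
  have "[:q:] * ([:s:] * f) = d * e" using prime.prems(3) by (simp add: mult_ac)
  then have "dvd_in (polys_over S) [:q:] (d * e)" using sf unfolding dvd_in_def by metis
  then consider "dvd_in (polys_over S) [:q:] d" | "dvd_in (polys_over S) [:q:] e"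
    using prime_inD(4)[OF q(2)] prime.prems by blast
  then show ?case
  proof cases
    case 1
    then obtain d1 where d1: "d1 \<in> polys_over S" "d = [:q:] * d1" by (auto simp: dvd_in_def)
    have "[:q:] * ([:s:] * f) = [:q:] * (d1 * e)"
      using \<open>[:q:] * ([:s:] * f) = d * e\<close> d1(2) by (simp only: mult.assoc)
    then have "[:s:] * f = d1 * e" using q(1) by (simp only: mult_cancel_left) auto
    then obtain d' e' s' where "d' \<in> polys_over S" "e' \<in> polys_over S" "s' \<in> S"
      "f = d' * e'" "d1 = [:s':] * d'"
      using prime.IH[OF d1(1) prime.prems(2)] by blast
    moreover from this have "d = [:q * s':] * d'" using d1 by (simp add: mult_ac)
    ultimately show ?thesis using q(3) is_subringD(4)[OF S] by blast
  next
    case 2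
    then obtain e1 where e1: "e1 \<in> polys_over S" "e = [:q:] * e1" by (auto simp: dvd_in_def)
    have "[:q:] * ([:s:] * f) = [:q:] * (d * e1)"
      using \<open>[:q:] * ([:s:] * f) = d * e\<close> e1(2) by (simp only: mult.left_commute)
    then have "[:s:] * f = d * e1" using q(1) by (simp only: mult_cancel_left) auto
    then show ?thesis using prime.IH[OF prime.prems(1) e1(1)] by blast
  qed
qed

text \<open>Pseudo-division: an element of least degree of an ideal divides all others up to constants.\<close>

lemma min_degree_pseudo_dvd:
  assumes S: "is_subring S"
    and I: "I \<subseteq> polys_over S" "\<And>f g. f \<in> I \<Longrightarrow> g \<in> I \<Longrightarrow> f - g \<in> I"
      "\<And>f g. f \<in> polys_over S \<Longrightarrow> g \<in> I \<Longrightarrow> f * g \<in> I"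
    and d: "d \<in> I" "d \<noteq> 0" "\<And>f. f \<in> I \<Longrightarrow> f \<noteq> 0 \<Longrightarrow> degree d \<le> degree f"
    and f: "f \<in> I"
  shows "\<exists>s\<in>S. s \<noteq> 0 \<and> dvd_in (polys_over S) d ([:s:] * f)"
  using f
\<comment> \<open>The remainder may be 0, whose degree is also 0; this measure puts 0 below the
  nonzero constants, where the degree alone would not decrease.\<close>
proof (induction "if f = 0 then 0 else Suc (degree f)" arbitrary: f rule: less_induct)
  note PS = is_subring_polys_over[OF S]
  case less
  show ?case
  proof (cases "f = 0")
    case True
    then show ?thesis using is_subringD(2)[OF S] dvd_in_0[OF PS]
      by (intro bexI[of _ 1]) auto
  next
    case False
    define n where "n = degree f - degree d"
    have n: "degree f = n + degree d" using d(3)[OF less(2) False] by (simp add: n_def)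
    define a b where "a = lead_coeff d" and "b = lead_coeff f"
    have ab: "a \<in> S" "b \<in> S" "a \<noteq> 0" "b \<noteq> 0"
      using d less(2) I(1) False by (auto simp: a_def b_def polys_over_def)
    \<comment> \<open>Leading coefficients cannot be divided, so both polynomials are scaled until
      their leading terms cancel.\<close>
    define f1 where "f1 = [:a:] * f - monom b n * d"
    have f1: "f1 \<in> I"
      unfolding f1_def using ab d(1) less(2) const_in_polys_over[OF S] monom_in_polys_over[OF S]
      by (intro I) auto
    have lt: "f1 = 0 \<or> degree f1 < degree f"
    proof (rule disjCI)
      assume "\<not> degree f1 < degree f"
      moreover have "degree f1 \<le> degree f"
        unfolding f1_def using n degree_mult_le[of "monom b n" d] degree_monom_le[of b n]
        by (intro degree_diff_le) (auto intro: order_trans)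
      moreover have "coeff f1 (degree f) = 0"
        unfolding f1_def by (simp add: n coeff_monom_mult a_def b_def)
      ultimately have "lead_coeff f1 = 0" by (simp add: order_antisym)
      then show "f1 = 0" by simp
    qed
    then have "(if f1 = 0 then 0 else Suc (degree f1)) < (if f = 0 then 0 else Suc (degree f))"
      using False by auto
    then obtain s e where s: "s \<in> S" "s \<noteq> 0" "e \<in> polys_over S" "[:s:] * f1 = d * e"
      using less(1)[OF _ f1] unfolding dvd_in_def by blast
    have "[:s * a:] * f = d * ([:s:] * monom b n + e)"
      using s(4) unfolding f1_def
      by (simp only: right_diff_distrib distrib_left diff_eq_eq) (simp add: mult_ac)
    moreover have "[:s:] * monom b n + e \<in> polys_over S"
      using s ab const_in_polys_over[OF S] monom_in_polys_over[OF S]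
      by (intro is_subringD(3,4)[OF PS]) auto
    ultimately show ?thesis using s ab is_subringD(4)[OF S]
      by (intro bexI[of _ "s * a"]) (auto simp: dvd_in_def)
  qed
qed

text \<open>Euclid's argument without a fraction field: an element \<open>d\<close> of least degree
  in the ideal of \<open>f\<close> and \<open>g\<close> serves as their gcd. If \<open>d\<close> is
  constant, a Bezout identity shows that \<open>f\<close> divides a constant multiple of
  \<open>h\<close>. Otherwise irreducibility makes \<open>d\<close> a constant multiple of
  \<open>f\<close>, which then divides a constant multiple of \<open>g\<close>. Primitivity of
  \<open>f\<close> removes these constants.\<close>

lemma primitive_prime_in:
  assumes S: "factorial_subring S"
    and f: "f \<in> polys_over S" "degree f > 0"
      "\<And>q. prime_in S q \<Longrightarrow> \<not> dvd_in (polys_over S) [:q:] f"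
      "\<And>g h. g \<in> polys_over S \<Longrightarrow> h \<in> polys_over S \<Longrightarrow> f = g * h \<Longrightarrow> degree g = 0 \<or> degree h = 0"
  shows "prime_in (polys_over S) f"
proof -
  have R: "is_subring S" and pp: "\<And>a. a \<in> S \<Longrightarrow> a \<noteq> 0 \<Longrightarrow> prime_product S a"
    using S by (auto simp: factorial_subring_def)
  note PS = is_subring_polys_over[OF R]
  have f0: "f \<noteq> 0" using f(2) by auto
  show ?thesis unfolding prime_in_def
  proof (intro conjI ballI impI)
    show "\<not> unit_in (polys_over S) f" using f(2) unit_in_polys_over_iff[OF R] by auto
    fix g h assume gh: "g \<in> polys_over S" "h \<in> polys_over S" "dvd_in (polys_over S) f (g * h)"
    define I where "I = {u * f + v * g |u v. u \<in> polys_over S \<and> v \<in> polys_over S}"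
    have II: "u * f + v * g \<in> I" if "u \<in> polys_over S" "v \<in> polys_over S" for u v
      using that by (auto simp: I_def)
    have fI: "f \<in> I" and gI: "g \<in> I"
      using II[of 1 0] II[of 0 1] is_subringD[OF PS] by auto
    have I1: "I \<subseteq> polys_over S"
      using f(1) gh(1) by (auto simp: I_def is_subringD[OF PS])
    have I2: "x - y \<in> I" if xy: "x \<in> I" "y \<in> I" for x y
    proof -
      obtain u v u' v' where "u \<in> polys_over S" "v \<in> polys_over S" "x = u * f + v * g"
        "u' \<in> polys_over S" "v' \<in> polys_over S" "y = u' * f + v' * g"
        using xy by (auto simp: I_def)
      then show ?thesis using II[of "u - u'" "v - v'"] is_subringD(6)[OF PS]
        by (simp add: algebra_simps)
    qed
    have I3: "y * x \<in> I" if xy: "x \<in> I" "y \<in> polys_over S" for x y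
    proof -
      obtain u v where "u \<in> polys_over S" "v \<in> polys_over S" "x = u * f + v * g"
        using xy by (auto simp: I_def)
      then show ?thesis using II[of "y * u" "y * v"] is_subringD(4)[OF PS] xy(2)
        by (simp add: algebra_simps)
    qed
    obtain d where d: "d \<in> I" "d \<noteq> 0" "\<And>x. x \<in> I \<Longrightarrow> x \<noteq> 0 \<Longrightarrow> degree d \<le> degree x"
      using ex_has_least_nat[of "\<lambda>x. x \<in> I \<and> x \<noteq> 0" f degree] fI f0 by blast
    have pdvd: "\<exists>s\<in>S. s \<noteq> 0 \<and> dvd_in (polys_over S) d ([:s:] * x)" if "x \<in> I" for x
      using min_degree_pseudo_dvd[OF R I1 I2 I3 d that] by blast
    show "dvd_in (polys_over S) f g \<or> dvd_in (polys_over S) f h"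
    proof (cases "degree d = 0")
      case True
      then obtain r where r: "d = [:r:]" using degree_eq_zeroE by metis
      have rS: "r \<in> S" "r \<noteq> 0" using d I1 r const_in_polys_over[OF R] by auto
      obtain u v where uv: "u \<in> polys_over S" "v \<in> polys_over S" "d = u * f + v * g"
        using d(1) by (auto simp: I_def)
      have "[:r:] * h = f * (u * h) + v * (g * h)"
        unfolding r[symmetric] uv(3) by (simp add: algebra_simps)
      moreover have "dvd_in (polys_over S) f (f * (u * h))"
        using uv(1) gh(2) is_subringD(4)[OF PS] by (auto simp: dvd_in_def)
      ultimately have "dvd_in (polys_over S) f ([:r:] * h)"
        using dvd_in_add[OF PS] dvd_in_mult2[OF PS gh(3) uv(2)] by simp
      then show ?thesis using dvd_in_cancel_const[OF R pp[OF rS] f(1,3) gh(2)] by blast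
    next
      case False
      obtain s e where s: "s \<in> S" "s \<noteq> 0" "e \<in> polys_over S" "[:s:] * f = d * e"
        using pdvd[OF fI] by (auto simp: dvd_in_def)
      obtain d' e' s' where d': "d' \<in> polys_over S" "e' \<in> polys_over S" "s' \<in> S"
        "f = d' * e'" "d = [:s':] * d'"
        using factor_const_split[OF R pp[OF s(1,2)] f(1) _ s(3,4)] d(1) I1 by blast
      have "degree d' \<noteq> 0" using d'(5) False degree_mult_le[of "[:s':]" d'] by auto
      then have "degree e' = 0" using f(4)[OF d'(1,2,4)] by simp
      then obtain e0 where e0: "e' = [:e0:]" using degree_eq_zeroE by metis
      have e0S: "e0 \<in> S" "e0 \<noteq> 0" using d' e0 const_in_polys_over[OF R] f0 by auto
      \<comment> \<open>A prime dividing \<open>e0\<close> would divide \<open>f\<close>, contrary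
        to primitivity.\<close>
      have "unit_in S e0"
      proof (rule prime_product_unit[OF R pp[OF e0S]])
        fix q assume q: "prime_in S q"
        show "\<not> dvd_in S q e0"
        proof
          assume "dvd_in S q e0"
          then obtain c where c: "c \<in> S" "e0 = q * c" by (auto simp: dvd_in_def)
          have "f = [:q:] * ([:c:] * d')" using d'(4) e0 c(2) by (simp add: mult_ac)
          moreover have "[:c:] * d' \<in> polys_over S"
            using c d' const_in_polys_over[OF R] by (intro is_subringD(4)[OF PS]) auto
          ultimately show False using f(3)[OF q] unfolding dvd_in_def by blast
        qed
      qed
      then obtain e1 where e1: "e1 \<in> S" "e0 * e1 = 1"
        using unit_in_inverse unit_in_def by metis
      have "d = f * ([:s':] * [:e1:])"
        using d'(4,5) e0 e1(2)
        by simp (metis mult.assoc mult.commute mult_1_left)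
      moreover have "[:s':] * [:e1:] \<in> polys_over S"
        using d'(3) e1(1) const_in_polys_over[OF R] by (intro is_subringD(4)[OF PS]) auto
      ultimately have fd: "dvd_in (polys_over S) f d" unfolding dvd_in_def by blast
      obtain t where t: "t \<in> S" "t \<noteq> 0" "dvd_in (polys_over S) d ([:t:] * g)"
        using pdvd[OF gI] by blast
      have "dvd_in (polys_over S) f ([:t:] * g)" using dvd_in_trans[OF PS fd t(3)] .
      then show ?thesis using dvd_in_cancel_const[OF R pp[OF t(1,2)] f(1,3) gh(1)] by blast
    qed
  qed (use f f0 in auto)
qed

text \<open>Constant prime factors are stripped off one by one; the leading coefficient bounds their
  number.\<close>

lemma strip_constants:
  assumes R: "is_subring S"
    and "f \<in> polys_over S" "f \<noteq> 0" "lead_coeff f = u * prod_mset M" "unit_in S u"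
      "\<And>p. p \<in># M \<Longrightarrow> prime_in S p"
  shows "\<exists>a g. prime_product S a \<and> g \<in> polys_over S \<and> f = [:a:] * g \<and>
           (\<forall>q. prime_in S q \<longrightarrow> \<not> dvd_in (polys_over S) [:q:] g)"
  using assms(2-)
proof (induction M arbitrary: f rule: measure_induct_rule[where f = size])
  note PS = is_subring_polys_over[OF R]
  case (less M)
  show ?case
  proof (cases "\<exists>p. p \<in># M \<and> dvd_in (polys_over S) [:p:] f")
    case True
    then obtain p g where p: "p \<in># M" "g \<in> polys_over S" "f = [:p:] * g"
      by (auto simp: dvd_in_def)
    have pp: "prime_in S p" "p \<noteq> 0" using less.prems p prime_inD by blast+
    have M: "M = add_mset p (M - {#p#})" using p(1) by simp
    have "p * lead_coeff g = p * (u * prod_mset (M - {#p#}))"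
      using less.prems(3) p(3) pp by (subst (asm) M) (simp add: lead_coeff_mult mult_ac)
    then have "lead_coeff g = u * prod_mset (M - {#p#})" using pp(2) by simp
    moreover have "size (M - {#p#}) < size M" by (subst (2) M) simp
    moreover have "g \<noteq> 0" using less.prems p by auto
    ultimately obtain a h where a: "prime_product S a" "h \<in> polys_over S" "g = [:a:] * h"
        "\<forall>q. prime_in S q \<longrightarrow> \<not> dvd_in (polys_over S) [:q:] h"
      using less.IH[of "M - {#p#}" g] p less.prems by (metis in_diffD)
    have "f = [:p * a:] * h" using p a by (simp add: mult_ac)
    then show ?thesis using a prime_product.prime[OF pp(1) a(1)] by blast
  next
    case False
    \<comment> \<open>Such a prime divides the leading coefficient, so it is associated to a member
      of \<open>M\<close>, and that member would divide \<open>f\<close> as well.\<close>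
    have "\<not> dvd_in (polys_over S) [:q:] f" if q: "prime_in S q" for q
    proof
      assume dq: "dvd_in (polys_over S) [:q:] f"
      have MS: "\<And>p. p \<in># M \<Longrightarrow> p \<in> S" using less.prems prime_inD by blast
      have "dvd_in S q (u * prod_mset M)"
        using dq const_dvd_in_iff[OF R, of q f] prime_inD[OF q] less.prems(3) by metis
      moreover have "\<not> dvd_in S q u"
        using dvd_in_trans[OF R] prime_in_not_dvd_1[OF q] less.prems(4) by (auto simp: unit_in_def)
      ultimately have "dvd_in S q (prod_mset M)"
        using prime_inD(4)[OF q] less.prems(4) is_subring_prod_mset[OF R, of M] MS
        by (auto simp: unit_in_def)
      then obtain p where p: "p \<in># M" "dvd_in S q p"
        using prime_in_dvd_prod_mset[OF R q MS] by blast
      then obtain e where e: "unit_in S e" "p = e * q"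
        using prime_in_dvd_prime[OF R q _ p(2)] less.prems(5) by blast
      obtain v where v: "unit_in S v" "e * v = 1" using unit_in_inverse[OF e(1)] .
      obtain h where h: "h \<in> polys_over S" "f = [:q:] * h" using dq by (auto simp: dvd_in_def)
      have "f = [:p:] * ([:v:] * h)" using e(2) v(2) h(2)
        by simp (metis mult.assoc mult.commute mult_1_left smult_smult)
      moreover have "[:v:] * h \<in> polys_over S"
        using v h const_in_polys_over[OF R] by (intro is_subringD(4)[OF PS]) (auto simp: unit_in_def)
      ultimately show False using False p(1) unfolding dvd_in_def by blast
    qed
    moreover have "unit_in S 1" using is_subringD(2)[OF R] by (auto simp: unit_in_def dvd_in_def)
    ultimately show ?thesis using less.prems(1)
      by (intro exI[of _ 1] exI[of _ f]) (auto intro: prime_product.unit)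
  qed
qed

text \<open>Gauss' theorem, by induction on the degree. A splitting into factors of positive degree
  is settled by induction; if there is none, what remains after stripping constants is prime by
  \<open>primitive_prime_in\<close>.\<close>

lemma factorial_polys_over:
  assumes S: "factorial_subring S"
  shows "factorial_subring (polys_over S)"
proof -
  have R: "is_subring S" and pp: "\<And>a. a \<in> S \<Longrightarrow> a \<noteq> 0 \<Longrightarrow> prime_product S a"
    using S by (auto simp: factorial_subring_def)
  note PS = is_subring_polys_over[OF R]
  have "prime_product (polys_over S) f" if "f \<in> polys_over S" "f \<noteq> 0" for f
    using that
  proof (induction "degree f" arbitrary: f rule: less_induct)
    case less
    show ?case
    proof (cases "degree f = 0")
      case True
      then obtain a where "f = [:a:]" using degree_eq_zeroE by metis
      then show ?thesis using less.prems const_in_polys_over[OF R] pp prime_product_const[OF R] by auto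
    next
      case False
      show ?thesis
      proof (cases "\<exists>g h. g \<in> polys_over S \<and> h \<in> polys_over S \<and> f = g * h \<and> degree g > 0 \<and> degree h > 0")
        case True
        then obtain g h where gh: "g \<in> polys_over S" "h \<in> polys_over S" "f = g * h"
          "degree g > 0" "degree h > 0" by blast
        then have "g \<noteq> 0" "h \<noteq> 0" by auto
        then have "degree g < degree f" "degree h < degree f"
          using gh by (auto simp: degree_mult_eq)
        then show ?thesis
          using less.hyps gh \<open>g \<noteq> 0\<close> \<open>h \<noteq> 0\<close> prime_product_mult[OF PS] by simp
      next
        case irred: False
        have "lead_coeff f \<in> S" "lead_coeff f \<noteq> 0" using less.prems by (auto simp: polys_over_def)
        then obtain u M where "unit_in S u" "\<And>q. q \<in># M \<Longrightarrow> prime_in S q"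
            "lead_coeff f = u * prod_mset M"
          using prime_product_mset[OF pp] by metis
        then obtain a g where a: "prime_product S a" "g \<in> polys_over S" "f = [:a:] * g"
            "\<And>q. prime_in S q \<Longrightarrow> \<not> dvd_in (polys_over S) [:q:] g"
          using strip_constants[OF R less.prems, of u M] by metis
        have "a \<noteq> 0" using prime_product_nonzero a(1) by blast
        have aS: "a \<in> S" using prime_product_in[OF R a(1)] .
        have dg: "degree g > 0" using False a(3) degree_mult_le[of "[:a:]" g] by auto
        have "prime_in (polys_over S) g"
        proof (rule primitive_prime_in[OF S a(2) dg a(4)])
          fix x y assume xy: "x \<in> polys_over S" "y \<in> polys_over S" "g = x * y"
          have "f = ([:a:] * x) * y" using a(3) xy(3) by (simp add: mult_ac)
          moreover have "[:a:] * x \<in> polys_over S"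
            using xy aS const_in_polys_over[OF R] by (intro is_subringD(4)[OF PS]) auto
          ultimately have "degree ([:a:] * x) = 0 \<or> degree y = 0" using irred xy(2) by (metis gr0I)
          then show "degree x = 0 \<or> degree y = 0" using \<open>a \<noteq> 0\<close> by simp
        qed
        then have "prime_product (polys_over S) (g * [:a:])"
          using prime_product_const[OF R a(1)] by (rule prime_product.prime)
        then show ?thesis using a(3) by (simp add: mult.commute)
      qed
    qed
  qed
  then show ?thesis using PS by (auto simp: factorial_subring_def)
qed

section \<open>Polynomial expressions as finitely supported functions\<close>

definition mon :: "('n::finite \<Rightarrow> 'a::comm_monoid_mult) \<Rightarrow> ('n \<Rightarrow> nat) \<Rightarrow> 'a" where
  "mon z I = (\<Prod>i\<in>UNIV. z i ^ I i)"

definition supp :: "('i \<Rightarrow> rat) \<Rightarrow> 'i set" where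
  "supp l = {I. l I \<noteq> 0}"

text \<open>The target field is left open: at rational points \<open>ev\<close> yields the layers of
  ELT values, at algebraically independent reals it embeds the polynomials into the reals.\<close>

definition ev :: "('n::finite \<Rightarrow> 'a::field_char_0) \<Rightarrow> (('n \<Rightarrow> nat) \<Rightarrow> rat) \<Rightarrow> 'a" where
  "ev z l = (\<Sum>I\<in>supp l. of_rat (l I) * mon z I)"

text \<open>Multiplication of polynomials in terms of coefficients; ranging over the supports keeps
  the sum finite.\<close>

definition conv :: "(('n \<Rightarrow> nat) \<Rightarrow> rat) \<Rightarrow> (('n \<Rightarrow> nat) \<Rightarrow> rat) \<Rightarrow> ('n \<Rightarrow> nat) \<Rightarrow> rat" where
  "conv l m K = (\<Sum>p \<in> {p \<in> supp l \<times> supp m. (\<lambda>i. fst p i + snd p i) = K}. l (fst p) * m (snd p))"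

lemma mon_add: "mon z (\<lambda>i. I i + J i) = mon z I * mon z J"
  by (simp add: mon_def power_add prod.distrib)

lemma mon_0 [simp]: "mon z (\<lambda>i. 0) = 1"
  by (simp add: mon_def)

lemma ev_superset:
  assumes "finite G" "supp l \<subseteq> G"
  shows "ev z l = (\<Sum>I\<in>G. of_rat (l I) * mon z I)"
  unfolding ev_def using assms by (intro sum.mono_neutral_left) (auto simp: supp_def)

lemma ev_add:
  assumes "finite (supp l)" "finite (supp m)"
  shows "ev z (\<lambda>I. l I + m I) = ev z l + ev z m"
proof -
  let ?G = "supp l \<union> supp m"
  have "ev z (\<lambda>I. l I + m I) = (\<Sum>I\<in>?G. of_rat (l I + m I) * mon z I)"
    using assms by (intro ev_superset) (auto simp: supp_def)
  moreover have "ev z l = (\<Sum>I\<in>?G. of_rat (l I) * mon z I)"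
    using assms by (intro ev_superset) auto
  moreover have "ev z m = (\<Sum>I\<in>?G. of_rat (m I) * mon z I)"
    using assms by (intro ev_superset) auto
  ultimately show ?thesis by (simp add: of_rat_add distrib_right sum.distrib)
qed

lemma supp_scale: "r \<noteq> 0 \<Longrightarrow> supp (\<lambda>I. r * l I) = supp l"
  by (auto simp: supp_def)

lemma ev_scale: "ev z (\<lambda>I. r * l I) = of_rat r * ev z l"
proof (cases "r = 0")
  case True
  then show ?thesis by (simp add: ev_def supp_def)
next
  case False
  then show ?thesis by (simp add: ev_def supp_scale of_rat_mult sum_distrib_left mult_ac)
qed

lemma ev_single: "ev z (\<lambda>J. if J = I then r else 0) = of_rat r * mon z I"
  by (subst ev_superset[of "{I}"]) (auto simp: supp_def)

lemma supp_conv: "supp (conv l m) \<subseteq> (\<lambda>p i. fst p i + snd p i) ` (supp l \<times> supp m)"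
proof
  fix K assume "K \<in> supp (conv l m)"
  then have "{p \<in> supp l \<times> supp m. (\<lambda>i. fst p i + snd p i) = K} \<noteq> {}"
    by (auto simp: supp_def[of "conv l m"] conv_def simp del: Collect_empty_eq)
  then show "K \<in> (\<lambda>p i. fst p i + snd p i) ` (supp l \<times> supp m)" by blast
qed

lemma ev_conv:
  assumes "finite (supp l)" "finite (supp m)"
  shows "ev z (conv l m) = ev z l * ev z m"
proof -
  let ?s = "\<lambda>p i. fst p i + snd p i"
  let ?X = "supp l \<times> supp m"
  have "ev z (conv l m) = (\<Sum>K\<in>?s ` ?X. of_rat (conv l m K) * mon z K)"
    using assms supp_conv by (intro ev_superset) auto
  also have "\<dots> = (\<Sum>K\<in>?s ` ?X. \<Sum>p\<in>{p\<in>?X. ?s p = K}.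
      of_rat (l (fst p)) * of_rat (m (snd p)) * mon z (?s p))"
    by (intro sum.cong refl)
      (simp add: conv_def of_rat_sum of_rat_mult sum_distrib_right)
  also have "\<dots> = (\<Sum>p\<in>?X. of_rat (l (fst p)) * of_rat (m (snd p)) * mon z (?s p))"
    using assms by (intro sum.image_gen[symmetric]) auto
  also have "\<dots> = ev z l * ev z m"
    unfolding ev_def sum_product
    by (simp add: sum.cartesian_product case_prod_unfold mon_add mult_ac)
  finally show ?thesis .
qed

text \<open>Try the weights \<open>n ^ e i\<close> with distinct \<open>e i\<close>. A collision of
  \<open>I\<close> and \<open>J\<close> makes \<open>n\<close> a root of the nonzero integer
  polynomial \<open>q I J\<close>, so all but finitely many \<open>n\<close> work. Such weights
  reduce several variables to one, and later break ties between maximal monomials.\<close>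

lemma generic_weights:
  fixes G :: "('n::finite \<Rightarrow> nat) set"
  assumes "finite G"
  shows "\<exists>w::'n \<Rightarrow> nat. inj_on (\<lambda>I. \<Sum>i\<in>UNIV. w i * I i) G"
proof -
  obtain e :: "'n \<Rightarrow> nat" where e: "inj e"
    using finite_imp_inj_to_nat_seg[OF finite_UNIV] by blast
  define q :: "('n \<Rightarrow> nat) \<Rightarrow> ('n \<Rightarrow> nat) \<Rightarrow> int poly" where
    "q I J = (\<Sum>i\<in>UNIV. monom (int (I i) - int (J i)) (e i))" for I J
  have coeff_q: "coeff (q I J) (e i) = int (I i) - int (J i)" for I J i
  proof -
    have "coeff (q I J) (e i) = (\<Sum>j\<in>UNIV. if j = i then int (I j) - int (J j) else 0)"
      unfolding q_def coeff_sum using e by (intro sum.cong) (auto dest: injD)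
    then show ?thesis by simp
  qed
  have q0: "q I J \<noteq> 0" if "I \<noteq> J" for I J
  proof
    assume "q I J = 0"
    then have "I i = J i" for i using coeff_q[of I J i] by simp
    then show False using that by auto
  qed
  define Z where "Z = (\<Union>p\<in>{p\<in>G\<times>G. fst p \<noteq> snd p}. {t. poly (q (fst p) (snd p)) t = 0})"
  have "finite Z" unfolding Z_def using assms q0 by (auto intro!: poly_roots_finite)
  then have "finite (int -` Z)" by (intro finite_vimageI) auto
  then obtain n where n: "int n \<notin> Z" using ex_new_if_finite[OF infinite_UNIV_nat] by blast
  have "inj_on (\<lambda>I. \<Sum>i\<in>UNIV. n ^ e i * I i) G"
  proof (rule inj_onI, rule ccontr)
    fix I J assume IJ: "I \<in> G" "J \<in> G" "(\<Sum>i\<in>UNIV. n ^ e i * I i) = (\<Sum>i\<in>UNIV. n ^ e i * J i)" "I \<noteq> J"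
    have "int (\<Sum>i\<in>UNIV. n ^ e i * I i) = int (\<Sum>i\<in>UNIV. n ^ e i * J i)" using IJ(3) by simp
    then have "poly (q I J) (int n) = 0"
      by (simp add: q_def poly_sum poly_monom right_diff_distrib sum_subtractf mult.commute)
    then have "int n \<in> Z" unfolding Z_def using IJ by force
    then show False using n by simp
  qed
  then show ?thesis by (intro exI[of _ "\<lambda>i. n ^ e i"])
qed

text \<open>Substituting \<open>t ^ w i\<close> with separating weights \<open>w\<close> yields a
  univariate polynomial with the same coefficients, of which every rational is a root.\<close>

lemma ev_rat_eq_0:
  fixes l :: "('n::finite \<Rightarrow> nat) \<Rightarrow> rat"
  assumes fin: "finite (supp l)" and ev: "\<And>z :: 'n \<Rightarrow> rat. ev z l = 0"
  shows "l I = 0"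
proof -
  obtain w :: "'n \<Rightarrow> nat" where w: "inj_on (\<lambda>I. \<Sum>i\<in>UNIV. w i * I i) (supp l)"
    using generic_weights[OF fin] by blast
  define d where "d I = (\<Sum>i\<in>UNIV. w i * I i)" for I
  define p where "p = (\<Sum>I\<in>supp l. monom (l I) (d I))"
  have "poly p t = 0" for t
  proof -
    have "mon (\<lambda>i. t ^ w i) I = t ^ d I" for I
      by (simp add: mon_def d_def power_sum flip: power_mult)
    then show ?thesis using ev[of "\<lambda>i. t ^ w i"]
      by (simp add: ev_def p_def poly_sum poly_monom)
  qed
  then have "p = 0" using poly_all_0_iff_0 by blast
  show ?thesis
  proof (rule ccontr)
    assume "l I \<noteq> 0"
    then have I: "I \<in> supp l" by (simp add: supp_def)
    have "coeff p (d I) = (\<Sum>J\<in>supp l. if J = I then l J else 0)"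
      unfolding p_def coeff_sum using w I
      by (intro sum.cong) (auto simp: d_def dest: inj_onD)
    then show False using \<open>p = 0\<close> \<open>l I \<noteq> 0\<close> fin I by simp
  qed
qed

lemma ev_rat_eq:
  fixes l m :: "('n::finite \<Rightarrow> nat) \<Rightarrow> rat"
  assumes "finite (supp l)" "finite (supp m)" "\<And>z :: 'n \<Rightarrow> rat. ev z l = ev z m"
  shows "l = m"
proof
  fix I
  have s: "supp (\<lambda>I. - 1 * m I) = supp m" by (rule supp_scale) simp
  have "finite (supp (\<lambda>I. l I + - 1 * m I))"
    by (rule finite_subset[of _ "supp l \<union> supp m"]) (use assms in \<open>auto simp: supp_def\<close>)
  moreover have "ev z (\<lambda>I. l I + - 1 * m I) = 0" for z :: "'n \<Rightarrow> rat"
    using ev_add[of l "\<lambda>I. - 1 * m I" z] ev_scale[of z "- 1" m] assms s by simp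
  ultimately have "l I + - 1 * m I = 0" by (rule ev_rat_eq_0)
  then show "l I = m I" by simp
qed

section \<open>Algebraically independent reals\<close>

definition ev_range :: "('n::finite \<Rightarrow> real) \<Rightarrow> 'n set \<Rightarrow> real set" where
  "ev_range \<theta> A = {ev \<theta> l |l. finite (supp l) \<and> (\<forall>I\<in>supp l. \<forall>i. i \<notin> A \<longrightarrow> I i = 0)}"

definition alg_indep :: "('n::finite \<Rightarrow> real) \<Rightarrow> 'n set \<Rightarrow> bool" where
  "alg_indep \<theta> A \<longleftrightarrow> (\<forall>l. finite (supp l) \<longrightarrow> (\<forall>I\<in>supp l. \<forall>i. i \<notin> A \<longrightarrow> I i = 0) \<longrightarrow>
     ev \<theta> l = 0 \<longrightarrow> (\<forall>I. l I = 0))"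

lemma is_subring_ev_range: "is_subring (ev_range \<theta> A)"
  unfolding is_subring_def
proof (intro conjI ballI)
  have single: "of_rat r * mon \<theta> (\<lambda>i. 0) \<in> ev_range \<theta> A" for r
    unfolding ev_range_def mem_Collect_eq
    by (rule exI[of _ "\<lambda>J. if J = (\<lambda>i. 0) then r else 0"])
      (auto simp: ev_single supp_def split: if_splits intro: finite_subset[of _ "{\<lambda>i. 0}"])
  show "0 \<in> ev_range \<theta> A" "1 \<in> ev_range \<theta> A" using single[of 0] single[of 1] by auto
  fix a assume "a \<in> ev_range \<theta> A"
  then obtain l where l: "a = ev \<theta> l" "finite (supp l)" "\<forall>I\<in>supp l. \<forall>i. i \<notin> A \<longrightarrow> I i = 0"
    by (auto simp: ev_range_def)
  have s: "supp (\<lambda>I. - 1 * l I) = supp l" by (rule supp_scale) simp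
  show "- a \<in> ev_range \<theta> A"
    unfolding ev_range_def mem_Collect_eq using l s ev_scale[of \<theta> "- 1" l]
    by (intro exI[of _ "\<lambda>I. - 1 * l I"]) simp
  fix b assume "b \<in> ev_range \<theta> A"
  then obtain m where m: "b = ev \<theta> m" "finite (supp m)" "\<forall>I\<in>supp m. \<forall>i. i \<notin> A \<longrightarrow> I i = 0"
    by (auto simp: ev_range_def)
  have sub: "supp (\<lambda>I. l I + m I) \<subseteq> supp l \<union> supp m" by (auto simp: supp_def)
  then have "finite (supp (\<lambda>I. l I + m I))" using l m finite_subset by blast
  then show "a + b \<in> ev_range \<theta> A"
    unfolding ev_range_def mem_Collect_eq using l m sub
    by (intro exI[of _ "\<lambda>I. l I + m I"]) (auto simp: ev_add)
  have "finite (supp (conv l m))" using finite_subset[OF supp_conv] l m by blast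
  moreover have "\<forall>I\<in>supp (conv l m). \<forall>i. i \<notin> A \<longrightarrow> I i = 0"
    using supp_conv[of l m] l m by fastforce
  ultimately show "a * b \<in> ev_range \<theta> A"
    unfolding ev_range_def mem_Collect_eq using l m
    by (intro exI[of _ "conv l m"]) (auto simp: ev_conv)
qed

lemma countable_polys_over:
  assumes "countable S"
  shows "countable (polys_over S)"
proof (rule countable_subset)
  show "polys_over S \<subseteq> Poly ` lists S"
  proof
    fix p assume "p \<in> polys_over S"
    then have "coeffs p \<in> lists S" by (auto simp: coeffs_def polys_over_def in_lists_conv_set)
    then show "p \<in> Poly ` lists S" by (metis Poly_coeffs imageI)
  qed
qed (use assms in \<open>auto intro: countable_image countable_lists\<close>)

text \<open>The nonzero polynomials over a countable set are countably many and have finitely many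
  roots each, too few to exhaust the reals.\<close>

lemma ex_transcendental_over_countable:
  fixes S :: "real set"
  assumes S: "countable S" "0 \<in> S"
  shows "\<exists>x. \<forall>p\<in>polys_over S. poly p x = 0 \<longrightarrow> p = 0"
proof -
  have "countable (\<Union>p\<in>polys_over S - {0}. {x. poly p x = 0})"
    using countable_polys_over[OF S(1)] by (intro countable_UN) (auto intro!: countable_finite poly_roots_finite)
  then have "(\<Union>p\<in>polys_over S - {0}. {x. poly p x = 0}) \<noteq> UNIV"
    using uncountable_UNIV_real by metis
  then show ?thesis by blast
qed

lemma mon_upd:
  "mon (\<theta>(i := x)) I = x ^ I i * mon \<theta> (I(i := 0))" for \<theta> :: "'n::finite \<Rightarrow> 'a::comm_monoid_mult"
proof -
  have "mon (\<theta>(i := x)) I = x ^ I i * (\<Prod>j\<in>UNIV - {i}. \<theta> j ^ I j)"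
    unfolding mon_def by (subst prod.remove[of _ i]) (auto intro!: arg_cong2[of _ _ _ _ "(*)"] prod.cong)
  moreover have "mon \<theta> (I(i := 0)) = (\<Prod>j\<in>UNIV - {i}. \<theta> j ^ I j)"
    unfolding mon_def by (subst prod.remove[of _ i]) (auto intro!: prod.cong)
  ultimately show ?thesis by simp
qed

text \<open>The terms are collected by powers of the variable \<open>i\<close>, and
  \<open>L k\<close> is the coefficient of the \<open>k\<close>-th power. Without the guard
  \<open>J i = 0\<close>, \<open>L k\<close> would repeat each value at all exponents that differ
  only at \<open>i\<close>.\<close>

lemma ev_as_poly:
  fixes \<theta> :: "'n::finite \<Rightarrow> real"
  assumes fin: "finite (supp l)" and l: "\<forall>I\<in>supp l. \<forall>j. j \<notin> insert i A \<longrightarrow> I j = 0"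
  defines "L \<equiv> \<lambda>k J. if J i = 0 then l (J(i := k)) else 0"
  defines "p \<equiv> (\<Sum>I\<in>supp l. monom (of_rat (l I) * mon \<theta> (I(i := 0))) (I i))"
  shows "poly p x = ev (\<theta>(i := x)) l" "coeff p k = ev \<theta> (L k)" "finite (supp (L k))"
    "J \<in> supp (L k) \<Longrightarrow> j \<notin> A \<Longrightarrow> J j = 0"
proof -
  show "poly p x = ev (\<theta>(i := x)) l"
    by (simp add: p_def poly_sum poly_monom ev_def mon_upd mult_ac)
  let ?B = "{I\<in>supp l. I i = k}"
  have sub: "supp (L k) \<subseteq> (\<lambda>I. I(i := 0)) ` ?B"
  proof
    fix J assume "J \<in> supp (L k)"
    then have J: "J i = 0" "J(i := k) \<in> ?B" by (auto simp: supp_def L_def split: if_splits)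
    then have "J = (J(i := k))(i := 0)" by (metis fun_upd_triv fun_upd_upd)
    then show "J \<in> (\<lambda>I. I(i := 0)) ` ?B" using J(2) by blast
  qed
  show "finite (supp (L k))" by (rule finite_subset[OF sub]) (use fin in auto)
  show "J j = 0" if "J \<in> supp (L k)" "j \<notin> A"
    using sub that l by (cases "j = i") auto
  have inj: "inj_on (\<lambda>I. I(i := 0)) ?B"
  proof (rule inj_onI)
    fix I J assume "I \<in> ?B" "J \<in> ?B" "I(i := 0) = J(i := 0)"
    then show "I = J" by (metis (mono_tags, lifting) fun_upd_triv fun_upd_upd mem_Collect_eq)
  qed
  have "ev \<theta> (L k) = (\<Sum>J\<in>(\<lambda>I. I(i := 0)) ` ?B. of_rat (L k J) * mon \<theta> J)"
    using fin sub by (intro ev_superset) auto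
  also have "\<dots> = (\<Sum>I\<in>?B. of_rat (l I) * mon \<theta> (I(i := 0)))"
    by (subst sum.reindex[OF inj]) (auto intro!: sum.cong simp: L_def)
  also have "\<dots> = coeff p k"
    unfolding p_def coeff_sum using fin by (simp add: sum.If_cases Int_def)
  finally show "coeff p k = ev \<theta> (L k)" ..
qed

lemma ev_upd_outside:
  assumes "\<forall>I\<in>supp l. \<forall>j. j \<notin> A \<longrightarrow> I j = 0" "i \<notin> A"
  shows "ev (\<theta>(i := x)) l = ev \<theta> l"
proof -
  have I: "I(i := 0) = I" "I i = 0" if "I \<in> supp l" for I using assms that by auto
  show ?thesis unfolding ev_def mon_upd by (intro sum.cong refl) (simp only: I power_0 mult_1_left)
qed

text \<open>Reduces the adjunction of a variable to univariate polynomials. As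
  \<open>i \<notin> A\<close>, the new value \<open>x\<close> leaves the coefficients, elements of
  \<open>ev_range \<theta> A\<close>, unchanged.\<close>

lemma ev_range_insert:
  assumes i: "i \<notin> A"
  shows "ev_range (\<theta>(i := x)) (insert i A) = (\<lambda>p. poly p x) ` polys_over (ev_range \<theta> A)"
proof (intro equalityI subsetI)
  fix a assume "a \<in> ev_range (\<theta>(i := x)) (insert i A)"
  then obtain l where l: "finite (supp l)" "\<forall>I\<in>supp l. \<forall>j. j \<notin> insert i A \<longrightarrow> I j = 0"
      "a = ev (\<theta>(i := x)) l"
    unfolding ev_range_def by blast
  note P = ev_as_poly[of l i A, OF l(1,2)]
  show "a \<in> (\<lambda>p. poly p x) ` polys_over (ev_range \<theta> A)"
    unfolding l(3) P(1)[of \<theta> x, symmetric]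
  proof (rule imageI)
    show "(\<Sum>I\<in>supp l. monom (of_rat (l I) * mon \<theta> (I(i := 0))) (I i)) \<in> polys_over (ev_range \<theta> A)"
      unfolding polys_over_def ev_range_def mem_Collect_eq P(2) using P(3,4) by blast
  qed
next
  let ?U = "ev_range (\<theta>(i := x)) (insert i A)"
  note U = is_subring_ev_range[of "\<theta>(i := x)" "insert i A"]
  fix a assume "a \<in> (\<lambda>p. poly p x) ` polys_over (ev_range \<theta> A)"
  then obtain p where p: "\<And>k. coeff p k \<in> ev_range \<theta> A" "a = poly p x"
    by (auto simp: polys_over_def)
  have "coeff p k \<in> ?U" for k
  proof -
    obtain l where l: "finite (supp l)" "\<forall>I\<in>supp l. \<forall>j. j \<notin> A \<longrightarrow> I j = 0"
        "coeff p k = ev \<theta> l"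
      using p(1)[of k] unfolding ev_range_def by blast
    then have "coeff p k = ev (\<theta>(i := x)) l" using l(3) ev_upd_outside[OF l(2) i, of \<theta> x] by (simp only:)
    then show ?thesis unfolding ev_range_def using l(1,2) by blast
  qed
  moreover have "x \<in> ?U"
  proof -
    let ?e = "\<lambda>j. if j = i then 1 else (0::nat)"
    have "mon (\<theta>(i := x)) ?e = x"
    proof -
      have "?e(i := 0) = (\<lambda>j. 0)" by auto
      then show ?thesis by (simp only: mon_upd) simp
    qed
    then have "x = ev (\<theta>(i := x)) (\<lambda>J. if J = ?e then 1 else 0)" by (simp only: ev_single) simp
    then show ?thesis unfolding ev_range_def mem_Collect_eq
      by (intro exI[of _ "\<lambda>J. if J = ?e then 1 else 0"])
        (auto simp: supp_def split: if_splits intro: finite_subset[of _ "{?e}"])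
  qed
  ultimately show "a \<in> ?U"
    unfolding p(2) poly_altdef by (intro is_subring_sum[OF U] is_subringD(4,7)[OF U])
qed

text \<open>Each new real is transcendental over the ring built so far, so evaluation at it is
  injective and transports Gauss' theorem. Countability is part of the invariant because it supplies
  the next real, and rationality of units because units have to match constant functions.\<close>

lemma ex_alg_indep:
  fixes A :: "'n::finite set"
  assumes "finite A"
  shows "\<exists>\<theta>::'n \<Rightarrow> real. alg_indep \<theta> A \<and> factorial_subring (ev_range \<theta> A) \<and>
    (\<forall>u. unit_in (ev_range \<theta> A) u \<longrightarrow> u \<in> \<rat>) \<and> countable (ev_range \<theta> A)"
  using assms
proof (induction A rule: finite_induct)
  case empty
  define \<theta> :: "'n \<Rightarrow> real" where "\<theta> = (\<lambda>i. 0)"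
  have ev0: "ev z l = of_rat (l (\<lambda>i. 0))" if "\<forall>I\<in>supp l. \<forall>i. i \<notin> {} \<longrightarrow> I i = 0" for l and z :: "'n \<Rightarrow> real"
  proof -
    have "supp l \<subseteq> {\<lambda>i. 0}" using that by auto
    then show ?thesis by (subst ev_superset[of "{\<lambda>i. 0}"]) auto
  qed
  have Q: "ev_range \<theta> {} = \<rat>"
  proof (intro equalityI subsetI)
    fix a assume "a \<in> ev_range \<theta> {}"
    then show "a \<in> \<rat>" using ev0 by (auto simp: ev_range_def)
  next
    fix a :: real assume "a \<in> \<rat>"
    then obtain r where r: "a = of_rat r" by (auto elim: Rats_cases)
    show "a \<in> ev_range \<theta> {}" unfolding ev_range_def mem_Collect_eq
      by (rule exI[of _ "\<lambda>J. if J = (\<lambda>i. 0) then r else 0"])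
        (auto simp: ev_single r supp_def split: if_splits intro: finite_subset[of _ "{\<lambda>i. 0}"])
  qed
  have "alg_indep \<theta> {}"
    unfolding alg_indep_def
  proof (intro allI impI)
    fix l I assume l: "\<forall>I\<in>supp l. \<forall>i. i \<notin> {} \<longrightarrow> I i = 0" "ev \<theta> l = 0"
    then have "l (\<lambda>i. 0) = 0" using ev0[OF l(1), of \<theta>] by simp
    moreover have "I = (\<lambda>i. 0)" if "l I \<noteq> 0" using l(1) that by (auto simp: supp_def)
    ultimately show "l I = 0" by blast
  qed
  moreover have "factorial_subring (\<rat> :: real set)"
    unfolding factorial_subring_def
  proof (intro conjI ballI impI)
    show "is_subring (\<rat> :: real set)" using is_subring_ev_range[of \<theta> "{}"] Q by simp
    fix a :: real assume a: "a \<in> \<rat>" "a \<noteq> 0"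
    then have "1 = a * inverse a" "inverse a \<in> \<rat>" by auto
    then have "unit_in \<rat> a" using a(1) unfolding unit_in_def dvd_in_def by blast
    then show "prime_product \<rat> a" by (rule prime_product.unit)
  qed
  ultimately show ?case using Q countable_rat by (intro exI[of _ \<theta>]) (auto simp: unit_in_def)
next
  case (insert i A)
  then obtain \<theta> :: "'n \<Rightarrow> real" where \<theta>: "alg_indep \<theta> A" "factorial_subring (ev_range \<theta> A)"
    "\<And>u. unit_in (ev_range \<theta> A) u \<Longrightarrow> u \<in> \<rat>" "countable (ev_range \<theta> A)" by blast
  define S where "S = ev_range \<theta> A"
  have R: "is_subring S" unfolding S_def by (rule is_subring_ev_range)
  obtain x where x: "\<And>p. p \<in> polys_over S \<Longrightarrow> poly p x = 0 \<Longrightarrow> p = 0"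
    using ex_transcendental_over_countable[of S] \<theta>(4) is_subringD(1)[OF R] by (auto simp: S_def)
  note PS = is_subring_polys_over[OF R]
  have inj: "inj_on (\<lambda>p. poly p x) (polys_over S)"
  proof (rule inj_onI)
    fix p q assume "p \<in> polys_over S" "q \<in> polys_over S" "poly p x = poly q x"
    then have "p - q = 0" using is_subringD(6)[OF PS] by (intro x) auto
    then show "p = q" by simp
  qed
  define \<theta>' where "\<theta>' = \<theta>(i := x)"
  have U: "ev_range \<theta>' (insert i A) = (\<lambda>p. poly p x) ` polys_over S"
    unfolding \<theta>'_def S_def by (rule ev_range_insert) (use insert in auto)
  have "alg_indep \<theta>' (insert i A)"
    unfolding alg_indep_def
  proof (intro allI impI)
    fix l I assume fin: "finite (supp l)" and l: "\<forall>I\<in>supp l. \<forall>j. j \<notin> insert i A \<longrightarrow> I j = 0"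
      and ev: "ev \<theta>' l = 0"
    note P = ev_as_poly[of l i A, OF fin l]
    have "(\<Sum>I\<in>supp l. monom (of_rat (l I) * mon \<theta> (I(i := 0))) (I i)) = 0"
    proof (rule x)
      show "(\<Sum>I\<in>supp l. monom (of_rat (l I) * mon \<theta> (I(i := 0))) (I i)) \<in> polys_over S"
        unfolding polys_over_def S_def ev_range_def mem_Collect_eq P(2) using P(3,4) by blast
    qed (use P(1)[of \<theta> x] ev in \<open>simp add: \<theta>'_def\<close>)
    then have "ev \<theta> (\<lambda>J. if J i = 0 then l (J(i := k)) else 0) = 0" for k
      by (simp flip: P(2))
    then have "(if J i = 0 then l (J(i := k)) else 0) = 0" for J k
      using \<theta>(1) P(3)[of k] P(4)[of _ k] unfolding alg_indep_def by blast
    from this[of "I(i := 0)" "I i"] show "l I = 0" by simp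
  qed
  moreover have "factorial_subring (ev_range \<theta>' (insert i A))"
    unfolding U using factorial_polys_over \<theta>(2) inj
    by (intro factorial_subring_image) (auto simp: S_def)
  moreover have "u \<in> \<rat>" if u: "unit_in (ev_range \<theta>' (insert i A)) u" for u
  proof -
    obtain p q where pq: "p \<in> polys_over S" "q \<in> polys_over S" "u = poly p x" "1 = poly p x * poly q x"
      using u unfolding unit_in_def dvd_in_def U by auto
    have "poly (p * q) x = poly 1 x" using pq(4) by simp
    then have "p * q = 1"
      using inj_onD[OF inj] is_subringD(2)[OF PS] is_subringD(4)[OF PS pq(1,2)] by blast
    then have "unit_in (polys_over S) p" unfolding unit_in_def dvd_in_def using pq(1,2) by metis
    then obtain a where "unit_in S a" "p = [:a:]" using unit_in_polys_over_iff[OF R] by blast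
    then show ?thesis using \<theta>(3) pq(3) by (simp add: S_def)
  qed
  moreover have "countable (ev_range \<theta>' (insert i A))"
    unfolding U using \<theta>(4) by (auto simp: S_def intro: countable_polys_over)
  ultimately show ?case by blast
qed

section \<open>Values of ELT polynomials\<close>

lemma elt_times_sel [simp]: "layer (x * y) = layer x * layer y" "tval (x * y) = tval x + tval y"
  by (simp_all add: times_elt_def)

lemma elt_one_sel [simp]: "layer (1 :: elt) = 1" "tval (1 :: elt) = 0"
  by (simp_all add: one_elt_def)

lemma elt_power_sel: "layer (x ^ n) = layer x ^ n" "tval (x ^ n) = of_nat n * tval x"
  by (induction n) (auto simp: algebra_simps)

lemma elt_prod_sel:
  "layer (\<Prod>i\<in>A. f i) = (\<Prod>i\<in>A. layer (f i))" "tval (\<Prod>i\<in>A. f i) = (\<Sum>i\<in>A. tval (f i))"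
  by (induction A rule: infinite_finite_induct) auto

lemma elt_sum_value:
  assumes "finite A" "\<And>i. i \<in> A \<Longrightarrow> tval (h i) \<le> M" "\<exists>i\<in>A. tval (h i) = M"
  shows "elt_sum h A = Elt (\<Sum>i\<in>{i \<in> A. tval (h i) = M}. layer (h i)) M"
proof -
  have "A \<noteq> {}" using assms(3) by auto
  with assms(1) show ?thesis using assms(2,3)
  proof (induction A arbitrary: M rule: finite_ne_induct)
    case (singleton i)
    then have "{j \<in> {i}. tval (h j) = M} = {i}" "tval (h i) = M" by auto
    then show ?case by (auto intro: elt.expand)
  next
    case (insert j A)
    \<comment> \<open>The maximum over the remaining terms; comparing it with
      \<open>tval (h j)\<close> gives the three cases of ELT addition.\<close>
    define N where "N = Max ((\<lambda>i. tval (h i)) ` A)"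
    have N: "tval (h i) \<le> N" if "i \<in> A" for i using insert.hyps that by (auto simp: N_def)
    have "N \<in> (\<lambda>i. tval (h i)) ` A" unfolding N_def using insert.hyps by (intro Max_in) auto
    then have exN: "\<exists>i\<in>A. tval (h i) = N" by auto
    have IH: "elt_sum h A = Elt (\<Sum>i\<in>{i \<in> A. tval (h i) = N}. layer (h i)) N"
      using N exN by (rule insert.IH)
    have M: "M = max (tval (h j)) N"
    proof (rule antisym)
      show "M \<le> max (tval (h j)) N" using insert.prems(2) N by (auto simp: le_max_iff_disj)
      show "max (tval (h j)) N \<le> M" using insert.prems(1) exN by auto
    qed
    have split: "{i \<in> insert j A. tval (h i) = M} =
        (if tval (h j) = M then insert j {i \<in> A. tval (h i) = M} else {i \<in> A. tval (h i) = M})"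
      by auto
    have empty: "{i \<in> A. tval (h i) = M} = {}" if "N < M" using N that by fastforce
    have sum: "elt_sum h (insert j A) = h j + elt_sum h A"
      using insert.hyps by (intro elt_sum_insert) auto
    consider "tval (h j) > N" | "tval (h j) < N" | "tval (h j) = N" by linarith
    then show ?case
    proof cases
      case 1
      then have Mj: "M = tval (h j)" using M by simp
      have "{i \<in> A. tval (h i) = M} = {}" using empty 1 Mj by simp
      then have e: "{i \<in> insert j A. tval (h i) = M} = {j}" using Mj by blast
      show ?thesis unfolding sum IH e using 1 Mj by (simp add: plus_elt_def)
    next
      case 2
      then show ?thesis unfolding sum IH split using M by (auto simp: plus_elt_def)
    next
      case 3
      then show ?thesis unfolding sum IH split using M insert.hyps by (auto simp: plus_elt_def)
    qed
  qed
qed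

definition dotp :: "('n::finite \<Rightarrow> nat) \<Rightarrow> ('n \<Rightarrow> real) \<Rightarrow> real" where
  "dotp I \<nu> = (\<Sum>i\<in>UNIV. real (I i) * \<nu> i)"

lemma dotp_simps:
  "dotp I (\<lambda>i. 0) = 0" "dotp I (\<lambda>i. \<mu> i + \<nu> i) = dotp I \<mu> + dotp I \<nu>"
  "dotp I (\<lambda>i. t * \<nu> i) = t * dotp I \<nu>" "dotp (\<lambda>i. I i + J i) \<nu> = dotp I \<nu> + dotp J \<nu>"
  by (simp_all add: dotp_def algebra_simps sum.distrib sum_distrib_left)

text \<open>Every point has this form. The layers \<open>\<xi>\<close> and the displacement
  \<open>\<nu>\<close> from \<open>\<alpha>\<close> vary independently: \<open>\<nu>\<close> selects
  the dominant monomials, \<open>\<xi>\<close> tests the polynomial formed by their layers.\<close>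

definition pt :: "('n \<Rightarrow> real) \<Rightarrow> ('n \<Rightarrow> rat) \<Rightarrow> ('n \<Rightarrow> real) \<Rightarrow> 'n \<Rightarrow> elt" where
  "pt \<alpha> \<xi> \<nu> i = Elt (\<xi> i) (\<alpha> i + \<nu> i)"

lemma pt_cases: obtains \<xi> \<nu> where "x = pt \<alpha> \<xi> \<nu>"
proof
  show "x = pt \<alpha> (\<lambda>i. layer (x i)) (\<lambda>i. tval (x i) - \<alpha> i)"
    by (auto simp: pt_def fun_eq_iff)
qed

lemma elt_monom_pt:
  "layer (elt_monom k I (pt \<alpha> \<xi> \<nu>)) = layer k * mon \<xi> I"
  "tval (elt_monom k I (pt \<alpha> \<xi> \<nu>)) = tval k + dotp I \<alpha> + dotp I \<nu>"
  by (simp_all add: elt_monom_def elt_prod_sel elt_power_sel pt_def mon_def dotp_def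
      distrib_left sum.distrib)

lemma elt_poly_pt:
  assumes "finite G" "\<And>I. I \<in> G \<Longrightarrow> tval (c I) + dotp I \<alpha> + dotp I \<nu> \<le> M"
    "\<exists>I\<in>G. tval (c I) + dotp I \<alpha> + dotp I \<nu> = M"
  shows "elt_poly G c (pt \<alpha> \<xi> \<nu>) =
    Elt (\<Sum>I\<in>{I \<in> G. tval (c I) + dotp I \<alpha> + dotp I \<nu> = M}. layer (c I) * mon \<xi> I) M"
  unfolding elt_poly_def using assms by (subst elt_sum_value[where M = M]) (auto simp: elt_monom_pt)

text \<open>The max-plus polynomial underlying the expression, centred at \<open>\<alpha>\<close>.
  Monomials of layer 0 count too, since they can dominate.\<close>

definition trop :: "('n::finite \<Rightarrow> nat) set \<Rightarrow> (('n \<Rightarrow> nat) \<Rightarrow> elt) \<Rightarrow> ('n \<Rightarrow> real) \<Rightarrow> ('n \<Rightarrow> real) \<Rightarrow> real" where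
  "trop G c \<alpha> \<nu> = Max ((\<lambda>I. tval (c I) + dotp I \<alpha> + dotp I \<nu>) ` G)"

lemma trop_ge: "finite G \<Longrightarrow> I \<in> G \<Longrightarrow> tval (c I) + dotp I \<alpha> + dotp I \<nu> \<le> trop G c \<alpha> \<nu>"
  unfolding trop_def by (intro Max_ge) auto

lemma trop_attained:
  assumes "finite G" "G \<noteq> {}"
  shows "\<exists>I\<in>G. tval (c I) + dotp I \<alpha> + dotp I \<nu> = trop G c \<alpha> \<nu>"
proof -
  have "trop G c \<alpha> \<nu> \<in> (\<lambda>I. tval (c I) + dotp I \<alpha> + dotp I \<nu>) ` G"
    unfolding trop_def using assms by (intro Max_in) auto
  then show ?thesis by auto
qed

lemma elt_poly_trop:
  assumes "finite G" "G \<noteq> {}"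
  shows "elt_poly G c (pt \<alpha> \<xi> \<nu>) = Elt (\<Sum>I\<in>{I \<in> G. tval (c I) + dotp I \<alpha> + dotp I \<nu> =
    trop G c \<alpha> \<nu>}. layer (c I) * mon \<xi> I) (trop G c \<alpha> \<nu>)"
  by (rule elt_poly_pt[OF assms(1) trop_ge[OF assms(1)] trop_attained[OF assms]])

section \<open>Symbols of regular polynomials that are primary at a point\<close>

text \<open>\<open>symbol \<alpha> l b f\<close> says that \<open>f\<close> is the sum of the monomials with layers \<open>l I \<noteq> 0\<close> that all
  have tangible value \<open>b\<close> at \<open>\<alpha>\<close>.\<close>

definition symbol :: "('n::finite \<Rightarrow> real) \<Rightarrow> (('n \<Rightarrow> nat) \<Rightarrow> rat) \<Rightarrow> real \<Rightarrow> (('n \<Rightarrow> elt) \<Rightarrow> elt) \<Rightarrow> bool" where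
  "symbol \<alpha> l b f \<longleftrightarrow> finite (supp l) \<and> supp l \<noteq> {} \<and>
     f = elt_poly (supp l) (\<lambda>I. Elt (l I) (b - dotp I \<alpha>))"

text \<open>The support function of the Newton polytope of \<open>l\<close>;
  \<open>init_form\<close> restricts \<open>l\<close> to the face on which it is attained.\<close>

definition maxdot :: "(('n::finite \<Rightarrow> nat) \<Rightarrow> rat) \<Rightarrow> ('n \<Rightarrow> real) \<Rightarrow> real" where
  "maxdot l \<nu> = Max ((\<lambda>I. dotp I \<nu>) ` supp l)"

definition init_form :: "(('n::finite \<Rightarrow> nat) \<Rightarrow> rat) \<Rightarrow> ('n \<Rightarrow> real) \<Rightarrow> ('n \<Rightarrow> nat) \<Rightarrow> rat" where
  "init_form l \<nu> I = (if dotp I \<nu> = maxdot l \<nu> then l I else 0)"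

lemma maxdot_ge: "finite (supp l) \<Longrightarrow> I \<in> supp l \<Longrightarrow> dotp I \<nu> \<le> maxdot l \<nu>"
  unfolding maxdot_def by (intro Max_ge) auto

lemma maxdot_attained:
  assumes "finite (supp l)" "supp l \<noteq> {}"
  shows "\<exists>I\<in>supp l. dotp I \<nu> = maxdot l \<nu>"
proof -
  have "maxdot l \<nu> \<in> (\<lambda>I. dotp I \<nu>) ` supp l"
    unfolding maxdot_def using assms by (intro Max_in) auto
  then show ?thesis by auto
qed

lemma maxdot_eqI:
  assumes "finite (supp l)" "\<And>I. I \<in> supp l \<Longrightarrow> dotp I \<nu> \<le> M" "\<exists>I\<in>supp l. dotp I \<nu> = M"
  shows "maxdot l \<nu> = M"
  unfolding maxdot_def using assms by (intro Max_eqI) auto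

lemma maxdot_0: "finite (supp l) \<Longrightarrow> supp l \<noteq> {} \<Longrightarrow> maxdot l (\<lambda>i. 0) = 0"
  by (intro maxdot_eqI) (auto simp: dotp_simps)

lemma init_form_0: "finite (supp l) \<Longrightarrow> supp l \<noteq> {} \<Longrightarrow> init_form l (\<lambda>i. 0) = l"
  by (auto simp: init_form_def maxdot_0 dotp_simps fun_eq_iff)

lemma maxdot_scale:
  assumes "finite (supp l)" "supp l \<noteq> {}" "t \<ge> 0"
  shows "maxdot l (\<lambda>i. t * \<nu> i) = t * maxdot l \<nu>"
proof (rule maxdot_eqI)
  show "\<exists>I\<in>supp l. dotp I (\<lambda>i. t * \<nu> i) = t * maxdot l \<nu>"
    using maxdot_attained[OF assms(1,2), of \<nu>] by (auto simp: dotp_simps)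
qed (use assms maxdot_ge[OF assms(1)] in \<open>auto simp: dotp_simps mult_left_mono\<close>)

lemma supp_init_form: "supp (init_form l \<nu>) = {I \<in> supp l. dotp I \<nu> = maxdot l \<nu>}"
  by (auto simp: supp_def init_form_def)

lemma init_form_nonempty: "finite (supp l) \<Longrightarrow> supp l \<noteq> {} \<Longrightarrow> supp (init_form l \<nu>) \<noteq> {}"
  using maxdot_attained[of l \<nu>] by (auto simp: supp_init_form)

text \<open>All monomials agree at \<open>\<alpha>\<close>, so after a displacement by
  \<open>\<nu>\<close> they compare by \<open>dotp I \<nu>\<close> alone.\<close>

lemma symbol_pt:
  assumes "symbol \<alpha> l b f"
  shows "f (pt \<alpha> \<xi> \<nu>) = Elt (ev \<xi> (init_form l \<nu>)) (b + maxdot l \<nu>)"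
proof -
  have fin: "finite (supp l)" "supp l \<noteq> {}" and f: "f = elt_poly (supp l) (\<lambda>I. Elt (l I) (b - dotp I \<alpha>))"
    using assms by (auto simp: symbol_def)
  have "f (pt \<alpha> \<xi> \<nu>) = Elt (\<Sum>I\<in>{I \<in> supp l. tval (Elt (l I) (b - dotp I \<alpha>)) + dotp I \<alpha> + dotp I \<nu> =
      b + maxdot l \<nu>}. layer (Elt (l I) (b - dotp I \<alpha>)) * mon \<xi> I) (b + maxdot l \<nu>)"
    unfolding f using fin(1) maxdot_ge[OF fin(1)] maxdot_attained[OF fin]
    by (intro elt_poly_pt) auto
  also have "\<dots> = Elt (ev \<xi> (init_form l \<nu>)) (b + maxdot l \<nu>)"
    by (auto simp: ev_def supp_init_form init_form_def of_rat_eq_id intro!: sum.cong)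
  finally show ?thesis .
qed

lemma symbolI:
  assumes fin: "finite (supp l)" "supp l \<noteq> {}"
    and f: "\<And>\<xi> \<nu>. f (pt \<alpha> \<xi> \<nu>) = Elt (ev \<xi> (init_form l \<nu>)) (b + maxdot l \<nu>)"
  shows "symbol \<alpha> l b f"
proof -
  define g where "g = elt_poly (supp l) (\<lambda>I. Elt (l I) (b - dotp I \<alpha>))"
  have g: "symbol \<alpha> l b g" unfolding symbol_def g_def using fin by blast
  have "f = g"
  proof
    fix x
    obtain \<xi> \<nu> where "x = pt \<alpha> \<xi> \<nu>" by (rule pt_cases)
    then show "f x = g x" using f symbol_pt[OF g] by simp
  qed
  then show ?thesis using g by simp
qed

lemma symbol_finite: "symbol \<alpha> l b f \<Longrightarrow> finite (supp l)" "symbol \<alpha> l b f \<Longrightarrow> supp l \<noteq> {}"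
  by (auto simp: symbol_def)

lemma symbol_exists: "finite (supp l) \<Longrightarrow> supp l \<noteq> {} \<Longrightarrow> \<exists>f. symbol \<alpha> l b f"
  unfolding symbol_def by blast

lemma symbol_is_elt_poly: "symbol \<alpha> l b f \<Longrightarrow> is_elt_poly f"
  unfolding symbol_def is_elt_poly_def by blast

lemma symbol_fun_eq: "symbol \<alpha> l b f \<Longrightarrow> symbol \<alpha> l b g \<Longrightarrow> f = g"
  unfolding symbol_def by blast

text \<open>At \<open>\<nu> = 0\<close> no monomial is dominated: the layer of the value is all of
  \<open>l\<close> evaluated at \<open>\<xi>\<close>, and rational points determine
  \<open>l\<close>.\<close>

lemma symbol_unique:
  assumes "symbol \<alpha> l b f" "symbol \<alpha> m d f"
  shows "l = m" "b = d"
proof -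
  note fin = symbol_finite[OF assms(1)] symbol_finite[OF assms(2)]
  have "Elt (ev \<xi> l) b = Elt (ev \<xi> m) d" for \<xi>
    using symbol_pt[OF assms(1), of \<xi> "\<lambda>i. 0"] symbol_pt[OF assms(2), of \<xi> "\<lambda>i. 0"] fin
    by (simp add: maxdot_0 init_form_0)
  then show "l = m" "b = d" using fin by (auto intro: ev_rat_eq)
qed

lemma symbol_scale:
  assumes f: "symbol \<alpha> l b f" and r: "r \<noteq> 0"
  shows "symbol \<alpha> (\<lambda>I. r * l I) (t + b) (\<lambda>x. Elt r t * f x)"
proof (rule symbolI)
  note s = supp_scale[OF r, of l]
  have "maxdot (\<lambda>I. r * l I) \<nu> = maxdot l \<nu>" for \<nu> by (simp add: maxdot_def s)
  moreover from this have "init_form (\<lambda>I. r * l I) \<nu> = (\<lambda>I. r * init_form l \<nu> I)" for \<nu>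
    by (auto simp: init_form_def fun_eq_iff)
  ultimately show "Elt r t * f (pt \<alpha> \<xi> \<nu>) =
      Elt (ev \<xi> (init_form (\<lambda>I. r * l I) \<nu>)) (t + b + maxdot (\<lambda>I. r * l I) \<nu>)" for \<xi> \<nu>
    by (simp add: symbol_pt[OF f] ev_scale of_rat_eq_id times_elt_def)
qed (use symbol_finite[OF f] supp_scale[OF r, of l] in auto)

section \<open>Symbols as elements of an integral domain: products and constants\<close>

lemma alg_indepD:
  assumes "alg_indep \<theta> UNIV" "finite (supp l)" "ev \<theta> l = 0"
  shows "l I = 0"
  using assms unfolding alg_indep_def by blast

lemma alg_indep_eq:
  assumes "alg_indep \<theta> UNIV" "finite (supp l)" "finite (supp m)" "ev \<theta> l = ev \<theta> m"
  shows "l = m"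
proof
  fix I
  have s: "supp (\<lambda>I. - 1 * m I) = supp m" by (rule supp_scale) simp
  have "finite (supp (\<lambda>I. l I + - 1 * m I))"
    by (rule finite_subset[of _ "supp l \<union> supp m"]) (use assms in \<open>auto simp: supp_def\<close>)
  moreover have "ev \<theta> (\<lambda>I. l I + - 1 * m I) = 0"
    using ev_add[of l "\<lambda>I. - 1 * m I" \<theta>] ev_scale[of \<theta> "- 1" m] assms s by simp
  ultimately have "l I + - 1 * m I = 0" using alg_indepD[OF assms(1)] by blast
  then show "l I = m I" by simp
qed

lemma finite_supp_conv: "finite (supp l) \<Longrightarrow> finite (supp m) \<Longrightarrow> finite (supp (conv l m))"
  by (rule finite_subset[OF supp_conv]) auto

text \<open>No zero divisors: evaluate at algebraically independent reals.\<close>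

lemma conv_nonzero:
  fixes l m :: "('n::finite \<Rightarrow> nat) \<Rightarrow> rat"
  assumes "finite (supp l)" "supp l \<noteq> {}" "finite (supp m)" "supp m \<noteq> {}"
  shows "supp (conv l m) \<noteq> {}"
proof
  obtain \<theta> :: "'n \<Rightarrow> real" where \<theta>: "alg_indep \<theta> UNIV" using ex_alg_indep[of UNIV] by auto
  assume "supp (conv l m) = {}"
  then have "ev \<theta> l * ev \<theta> m = 0" using assms by (simp flip: ev_conv) (simp add: ev_def)
  then consider "ev \<theta> l = 0" | "ev \<theta> m = 0" by auto
  then show False
  proof cases
    case 1
    then have "l I = 0" for I using alg_indepD[OF \<theta> assms(1)] by blast
    then show False using assms(2) by (simp add: supp_def)
  next
    case 2
    then have "m I = 0" for I using alg_indepD[OF \<theta> assms(3)] by blast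
    then show False using assms(4) by (simp add: supp_def)
  qed
qed

text \<open>A sum of two exponents reaches the total maximum only if both summands are maximal.
  Cancellation cannot empty this face, because the product of the two nonzero initial forms is
  nonzero.\<close>

lemma init_form_conv:
  assumes l: "finite (supp l)" "supp l \<noteq> {}" and m: "finite (supp m)" "supp m \<noteq> {}"
  shows "maxdot (conv l m) \<nu> = maxdot l \<nu> + maxdot m \<nu>"
    "init_form (conv l m) \<nu> = conv (init_form l \<nu>) (init_form m \<nu>)"
proof -
  let ?M = "maxdot l \<nu> + maxdot m \<nu>"
  have eq: "conv (init_form l \<nu>) (init_form m \<nu>) K = (if dotp K \<nu> = ?M then conv l m K else 0)" for K
  proof (cases "dotp K \<nu> = ?M")
    case True
    have "dotp (fst p) \<nu> = maxdot l \<nu> \<and> dotp (snd p) \<nu> = maxdot m \<nu>"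
      if "p \<in> supp l \<times> supp m" "(\<lambda>i. fst p i + snd p i) = K" for p
    proof -
      have "dotp K \<nu> = dotp (fst p) \<nu> + dotp (snd p) \<nu>" unfolding that(2)[symmetric] dotp_simps ..
      moreover have "dotp (fst p) \<nu> \<le> maxdot l \<nu>" "dotp (snd p) \<nu> \<le> maxdot m \<nu>"
        using that(1) maxdot_ge[OF l(1)] maxdot_ge[OF m(1)] by auto
      ultimately show ?thesis using True by linarith
    qed
    then have "{p \<in> supp (init_form l \<nu>) \<times> supp (init_form m \<nu>). (\<lambda>i. fst p i + snd p i) = K} =
        {p \<in> supp l \<times> supp m. (\<lambda>i. fst p i + snd p i) = K}"
      by (auto simp: supp_init_form)
    moreover have "init_form l \<nu> (fst p) * init_form m \<nu> (snd p) = l (fst p) * m (snd p)"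
      if "p \<in> supp (init_form l \<nu>) \<times> supp (init_form m \<nu>)" for p
      using that by (auto simp: supp_init_form) (auto simp: init_form_def)
    ultimately show ?thesis unfolding conv_def using True by (auto intro!: sum.cong)
  next
    case False
    have "{p \<in> supp (init_form l \<nu>) \<times> supp (init_form m \<nu>). (\<lambda>i. fst p i + snd p i) = K} = {}"
      using False by (auto simp: supp_init_form dotp_simps)
    then show ?thesis unfolding conv_def using False by (simp only: sum.empty if_False)
  qed
  have "finite (supp (init_form l \<nu>))" "finite (supp (init_form m \<nu>))"
    using l m by (simp_all add: supp_init_form)
  then obtain K where "K \<in> supp (conv (init_form l \<nu>) (init_form m \<nu>))"
    using conv_nonzero[OF _ init_form_nonempty[OF l] _ init_form_nonempty[OF m]] by blast
  then have K: "K \<in> supp (conv l m)" "dotp K \<nu> = ?M"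
    unfolding supp_def using eq[of K] by (auto split: if_splits)
  show max: "maxdot (conv l m) \<nu> = ?M"
  proof (rule maxdot_eqI)
    fix I assume "I \<in> supp (conv l m)"
    then obtain p where "p \<in> supp l \<times> supp m" "I = (\<lambda>i. fst p i + snd p i)"
      using supp_conv by blast
    then show "dotp I \<nu> \<le> ?M" using maxdot_ge[OF l(1)] maxdot_ge[OF m(1)]
      by (auto simp: dotp_simps intro!: add_mono)
  qed (use K l m finite_supp_conv in auto)
  show "init_form (conv l m) \<nu> = conv (init_form l \<nu>) (init_form m \<nu>)"
    unfolding init_form_def[of "conv l m"] max eq fun_eq_iff by simp
qed

lemma symbol_mult:
  assumes f: "symbol \<alpha> l b f" and g: "symbol \<alpha> m d g"
  shows "symbol \<alpha> (conv l m) (b + d) (\<lambda>x. f x * g x)"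
proof (rule symbolI)
  note fin = symbol_finite[OF f] symbol_finite[OF g]
  show "finite (supp (conv l m))" "supp (conv l m) \<noteq> {}"
    using finite_supp_conv[OF fin(1,3)] conv_nonzero[OF fin] by blast+
  show "f (pt \<alpha> \<xi> \<nu>) * g (pt \<alpha> \<xi> \<nu>) =
      Elt (ev \<xi> (init_form (conv l m) \<nu>)) (b + d + maxdot (conv l m) \<nu>)" for \<xi> \<nu>
    unfolding symbol_pt[OF f] symbol_pt[OF g] init_form_conv[OF fin]
    using fin by (subst ev_conv) (auto simp: times_elt_def supp_init_form)
qed

lemma symbol_const:
  fixes \<alpha> :: "'n::finite \<Rightarrow> real"
  assumes "r \<noteq> 0"
  shows "symbol \<alpha> (\<lambda>J. if J = (\<lambda>i. 0) then r else 0) b (\<lambda>x. Elt r b)"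
proof -
  let ?l = "\<lambda>J::'n \<Rightarrow> nat. if J = (\<lambda>i. 0) then r else 0"
  have s: "supp ?l = {\<lambda>i. 0}" using assms by (auto simp: supp_def)
  have d: "dotp (\<lambda>i. 0) \<nu> = 0" for \<nu> :: "'n \<Rightarrow> real"
    unfolding dotp_def by (intro sum.neutral) auto
  have m: "maxdot ?l \<nu> = 0" for \<nu> by (simp add: maxdot_def s d)
  have "init_form ?l \<nu> J = ?l J" for \<nu> J
    by (cases "J = (\<lambda>i. 0)") (simp_all only: init_form_def m d if_True if_False simp_thms if_cancel)
  then have "init_form ?l \<nu> = ?l" for \<nu> by (rule ext)
  then show ?thesis by (intro symbolI) (auto simp: s m ev_single of_rat_eq_id)
qed

text \<open>By independence \<open>ev \<theta> l\<close> is rational only if \<open>l\<close> is a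
  constant polynomial. Nonconstant functions thus correspond to nonunits of the ring.\<close>

lemma symbol_constant_iff:
  assumes \<theta>: "alg_indep \<theta> UNIV" and f: "symbol \<alpha> l b f"
  shows "constant_fun f \<longleftrightarrow> ev \<theta> l \<in> \<rat>"
proof
  note fin = symbol_finite[OF f]
  let ?s = "\<lambda>r J. if J = (\<lambda>i. 0) then r else (0::rat)"
  have fin_s: "finite (supp (?s r))" for r
    by (rule finite_subset[of _ "{\<lambda>i. 0}"]) (auto simp: supp_def)
  {
    assume "constant_fun f"
    then obtain k where k: "\<And>x. f x = k" by (auto simp: constant_fun_def)
    have "ev \<xi> l = ev \<xi> (?s (layer k))" for \<xi> :: "'a \<Rightarrow> rat"
      using symbol_pt[OF f, of \<xi> "\<lambda>i. 0"] fin k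
      by (simp add: ev_single of_rat_eq_id maxdot_0 init_form_0)
    then have "l = ?s (layer k)" using fin fin_s by (intro ev_rat_eq)
    then have "ev \<theta> l = of_rat (layer k)" by (simp only: ev_single) simp
    then show "ev \<theta> l \<in> \<rat>" by simp
  next
    assume "ev \<theta> l \<in> \<rat>"
    then obtain r where r: "ev \<theta> l = of_rat r" by (auto elim: Rats_cases)
    then have l: "l = ?s r" using fin fin_s by (intro alg_indep_eq[OF \<theta>]) (auto simp: ev_single)
    then have "r \<noteq> 0" using fin(2) by (auto simp: supp_def)
    then have "symbol \<alpha> l b (\<lambda>x. Elt r b)" unfolding l by (rule symbol_const)
    then have "f = (\<lambda>x. Elt r b)" using symbol_fun_eq[OF f] by blast
    then show "constant_fun f" by (auto simp: constant_fun_def)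
  }
qed

section \<open>From expressions to symbols\<close>

text \<open>The monomials left out of \<open>l\<close> either have layer 0, and add nothing to the
  layer where they are maximal, or are never maximal. \<open>ex\<close> prevents the tangible value
  from dropping without them. This serves both the given polynomial and its factors.\<close>

lemma symbol_elt_poly:
  fixes G :: "('n::finite \<Rightarrow> nat) set"
  assumes G: "finite G" "G \<noteq> {}"
    and ex: "\<And>\<nu>. \<exists>I\<in>G. tval (c I) + dotp I \<alpha> + dotp I \<nu> = trop G c \<alpha> \<nu> \<and> layer (c I) \<noteq> 0"
    and b: "\<And>\<nu> I. I \<in> G \<Longrightarrow> tval (c I) + dotp I \<alpha> + dotp I \<nu> = trop G c \<alpha> \<nu> \<Longrightarrow>
      layer (c I) \<noteq> 0 \<Longrightarrow> tval (c I) + dotp I \<alpha> = b"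
  shows "\<exists>l. symbol \<alpha> l b (elt_poly G c)"
proof
  define l where "l I = (if I \<in> G \<and> tval (c I) + dotp I \<alpha> = b then layer (c I) else 0)" for I
  have sub: "supp l \<subseteq> G" by (auto simp: supp_def l_def)
  have fin: "finite (supp l)" using finite_subset[OF sub G(1)] .
  have max: "maxdot l \<nu> = trop G c \<alpha> \<nu> - b" for \<nu>
  proof (rule maxdot_eqI[OF fin])
    show "dotp I \<nu> \<le> trop G c \<alpha> \<nu> - b" if "I \<in> supp l" for I
      using trop_ge[OF G(1), of I c \<alpha> \<nu>] that by (auto simp: supp_def l_def split: if_splits)
    obtain I where I: "I \<in> G" "tval (c I) + dotp I \<alpha> + dotp I \<nu> = trop G c \<alpha> \<nu>" "layer (c I) \<noteq> 0"
      using ex by blast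
    then have "tval (c I) + dotp I \<alpha> = b" using b by blast
    then show "\<exists>I\<in>supp l. dotp I \<nu> = trop G c \<alpha> \<nu> - b"
      using I by (intro bexI[of _ I]) (auto simp: supp_def l_def)
  qed
  show "symbol \<alpha> l b (elt_poly G c)"
  proof (rule symbolI[OF fin])
    obtain I where "I \<in> G" "tval (c I) + dotp I \<alpha> = b" "layer (c I) \<noteq> 0" using ex b by blast
    then show "supp l \<noteq> {}" by (auto simp: supp_def l_def)
    fix \<xi> :: "'n \<Rightarrow> rat" and \<nu>
    let ?S = "{I \<in> G. tval (c I) + dotp I \<alpha> + dotp I \<nu> = trop G c \<alpha> \<nu>}"
    have "ev \<xi> (init_form l \<nu>) = (\<Sum>I\<in>?S. of_rat (init_form l \<nu> I) * mon \<xi> I)"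
    proof (rule ev_superset)
      show "supp (init_form l \<nu>) \<subseteq> ?S"
        unfolding supp_init_form max by (auto simp: supp_def l_def split: if_splits)
    qed (use G in auto)
    also have "\<dots> = (\<Sum>I\<in>?S. layer (c I) * mon \<xi> I)"
    proof (rule sum.cong[OF refl])
      fix I assume I: "I \<in> ?S"
      have "init_form l \<nu> I = layer (c I)"
      proof (cases "layer (c I) = 0")
        case False
        then have "tval (c I) + dotp I \<alpha> = b" using b I by blast
        then show ?thesis using I by (auto simp: init_form_def max l_def)
      qed (auto simp: init_form_def l_def)
      then show "of_rat (init_form l \<nu> I) * mon \<xi> I = layer (c I) * mon \<xi> I"
        by (simp add: of_rat_eq_id)
    qed
    finally show "elt_poly G c (pt \<alpha> \<xi> \<nu>) = Elt (ev \<xi> (init_form l \<nu>)) (b + maxdot l \<nu>)"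
      by (simp add: elt_poly_trop[OF G] max)
  qed
qed

text \<open>At a point whose layers are all 1, the layer of the value is the sum of the layers of
  the maximal coefficients, and deleting \<open>I\<close> does not change it.\<close>

lemma inessential_max_layer:
  assumes G: "finite G" "G \<noteq> {}" and I: "I \<in> G" "inessential G c I"
    and max: "tval (c I) + dotp I \<alpha> + dotp I \<nu> = trop G c \<alpha> \<nu>"
  shows "layer (c I) = 0"
proof -
  have G': "finite (G - {I})" "G - {I} \<noteq> {}"
    and eq: "elt_poly (G - {I}) c (pt \<alpha> (\<lambda>i. 1) \<nu>) = elt_poly G c (pt \<alpha> (\<lambda>i. 1) \<nu>)"
    using G I(2) by (auto simp: inessential_def)
  have m1: "mon (\<lambda>i. 1) J = 1" for J :: "'a \<Rightarrow> nat" by (simp add: mon_def)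
  let ?S = "{J \<in> G. tval (c J) + dotp J \<alpha> + dotp J \<nu> = trop G c \<alpha> \<nu>}"
  have T: "trop (G - {I}) c \<alpha> \<nu> = trop G c \<alpha> \<nu>"
    and L: "(\<Sum>J\<in>{J \<in> G - {I}. tval (c J) + dotp J \<alpha> + dotp J \<nu> = trop (G - {I}) c \<alpha> \<nu>}. layer (c J)) =
      (\<Sum>J\<in>?S. layer (c J))"
    using eq unfolding elt_poly_trop[OF G] elt_poly_trop[OF G'] m1 by auto
  have "{J \<in> G - {I}. tval (c J) + dotp J \<alpha> + dotp J \<nu> = trop G c \<alpha> \<nu>} = ?S - {I}" by auto
  then have "(\<Sum>J\<in>?S - {I}. layer (c J)) = (\<Sum>J\<in>?S. layer (c J))" using L T by simp
  moreover have "(\<Sum>J\<in>?S. layer (c J)) = layer (c I) + (\<Sum>J\<in>?S - {I}. layer (c J))"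
    using G I max by (intro sum.remove) auto
  ultimately show ?thesis by simp
qed

text \<open>Perturbing the direction generically makes the maximum unique, and a monomial that is the
  unique maximum somewhere is essential.\<close>

lemma essential_max_exists:
  fixes G :: "('n::finite \<Rightarrow> nat) set"
  assumes G: "finite G" "G \<noteq> {}"
  shows "\<exists>I\<in>monomials G c. tval (c I) + dotp I \<alpha> + dotp I \<nu> = trop G c \<alpha> \<nu>"
proof -
  define v where "v I = tval (c I) + dotp I \<alpha> + dotp I \<nu>" for I
  define S where "S = {I \<in> G. v I = trop G c \<alpha> \<nu>}"
  have S: "finite S" "S \<noteq> {}" "S \<subseteq> G"
    using G trop_attained[OF G, of c \<alpha> \<nu>] by (auto simp: S_def v_def)
  obtain w :: "'n \<Rightarrow> nat" where w: "inj_on (\<lambda>I. \<Sum>i\<in>UNIV. w i * I i) G"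
    using generic_weights[OF G(1)] by blast
  define \<omega> where "\<omega> i = real (w i)" for i
  have dw: "dotp I \<omega> = real (\<Sum>i\<in>UNIV. w i * I i)" for I
    by (simp add: dotp_def \<omega>_def mult.commute)
  \<comment> \<open>Among the monomials tied at \<open>\<nu>\<close>, a displacement along
    \<open>\<omega>\<close> favours \<open>I\<close>. For small \<open>e > 0\<close> it beats the
    others in \<open>S\<close> by its slope and those outside \<open>S\<close> by
    continuity.\<close>
  obtain I where I: "I \<in> S" "\<And>J. J \<in> S \<Longrightarrow> dotp J \<omega> \<le> dotp I \<omega>"
    using obtains_MAX[OF S(1,2), of "\<lambda>J. dotp J \<omega>"] S(1)
    by (metis Max_ge finite_imageI imageI)
  have ev: "eventually (\<lambda>e. v J + e * dotp J \<omega> < v I + e * dotp I \<omega>) (at_right 0)"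
    if J: "J \<in> G - {I}" for J
  proof (cases "J \<in> S")
    case True
    have "dotp J \<omega> \<noteq> dotp I \<omega>" unfolding dw of_nat_eq_iff using inj_onD[OF w] J I(1) S(3) by blast
    then have "dotp J \<omega> < dotp I \<omega>" using I(2)[OF True] by simp
    moreover have "v J = v I" using True I by (simp add: S_def)
    ultimately show ?thesis using eventually_at_right_less[of "0::real"]
      by (auto elim: eventually_mono)
  next
    case False
    then have "v J < v I"
      using J I(1) trop_ge[OF G(1), of J c \<alpha> \<nu>] by (auto simp: S_def v_def)
    moreover have "((\<lambda>e. v I + e * dotp I \<omega> - (v J + e * dotp J \<omega>)) \<longlongrightarrow>
        v I + 0 * dotp I \<omega> - (v J + 0 * dotp J \<omega>)) (at_right 0)"
      by (intro tendsto_intros)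
    ultimately have "eventually (\<lambda>e. 0 < v I + e * dotp I \<omega> - (v J + e * dotp J \<omega>)) (at_right 0)"
      by (intro order_tendstoD) auto
    then show ?thesis by (rule eventually_mono) simp
  qed
  then have "eventually (\<lambda>e. \<forall>J\<in>G - {I}. v J + e * dotp J \<omega> < v I + e * dotp I \<omega>) (at_right 0)"
    using G by (intro eventually_ball_finite) auto
  then obtain e where e: "\<forall>J\<in>G - {I}. v J + e * dotp J \<omega> < v I + e * dotp I \<omega>"
    using eventually_happens' trivial_limit_at_right_real by blast
  have "\<not> inessential G c I"
  proof
    assume "inessential G c I"
    then have G': "finite (G - {I})" "G - {I} \<noteq> {}"
      and eq: "elt_poly (G - {I}) c (pt \<alpha> (\<lambda>i. 1) (\<lambda>i. \<nu> i + e * \<omega> i)) =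
        elt_poly G c (pt \<alpha> (\<lambda>i. 1) (\<lambda>i. \<nu> i + e * \<omega> i))"
      using G by (auto simp: inessential_def)
    let ?T = "\<lambda>G. trop G c \<alpha> (\<lambda>i. \<nu> i + e * \<omega> i)"
    have T: "?T (G - {I}) = ?T G"
      using eq unfolding elt_poly_trop[OF G] elt_poly_trop[OF G'] by simp
    obtain J where J: "J \<in> G - {I}" "v J + e * dotp J \<omega> = ?T (G - {I})"
      using trop_attained[OF G', of c \<alpha> "\<lambda>i. \<nu> i + e * \<omega> i"]
      by (auto simp: v_def dotp_simps add.assoc)
    have "v I + e * dotp I \<omega> \<le> ?T G"
      using trop_ge[OF G(1), of I c \<alpha> "\<lambda>i. \<nu> i + e * \<omega> i"] I S
      by (auto simp: v_def dotp_simps add.assoc)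
    moreover have "v J + e * dotp J \<omega> < v I + e * dotp I \<omega>" using e J(1) by blast
    ultimately show False using J(2) T by linarith
  qed
  then show ?thesis using I S by (intro bexI[of _ I]) (auto simp: monomials_def S_def v_def)
qed

text \<open>Every maximum is attained by an essential monomial, whose layer is nonzero by
  regularity. Conversely a maximal monomial of nonzero layer is essential, so being primary fixes
  its value at the point. These are the two premises of \<open>symbol_elt_poly\<close>.\<close>

lemma regular_primary_symbol:
  assumes G: "finite G" "G \<noteq> {}" and reg: "regular G c" and prim: "primary_at G c a"
  shows "\<exists>l b. symbol (\<lambda>i. tval (a i)) l b (elt_poly G c)"
proof -
  define \<alpha> where "\<alpha> = (\<lambda>i. tval (a i))"
  have ta: "tval (elt_monom (c I) I a) = tval (c I) + dotp I \<alpha>" for I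
    by (simp add: elt_monom_def elt_prod_sel elt_power_sel dotp_def \<alpha>_def)
  obtain I0 where I0: "I0 \<in> monomials G c" using essential_max_exists[OF G] by blast
  define b where "b = tval (c I0) + dotp I0 \<alpha>"
  have b: "tval (c I) + dotp I \<alpha> = b" if "I \<in> monomials G c" for I
    using prim[unfolded primary_at_def ta] that I0 unfolding b_def by blast
  have "\<exists>l. symbol \<alpha> l b (elt_poly G c)"
  proof (rule symbol_elt_poly[OF G])
    fix \<nu>
    show "\<exists>I\<in>G. tval (c I) + dotp I \<alpha> + dotp I \<nu> = trop G c \<alpha> \<nu> \<and> layer (c I) \<noteq> 0"
      using essential_max_exists[OF G, of c \<alpha> \<nu>] reg by (auto simp: regular_def monomials_def)
    fix I assume "I \<in> G" "tval (c I) + dotp I \<alpha> + dotp I \<nu> = trop G c \<alpha> \<nu>" "layer (c I) \<noteq> 0"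
    then have "I \<in> monomials G c" using inessential_max_layer[OF G] by (auto simp: monomials_def)
    then show "tval (c I) + dotp I \<alpha> = b" by (rule b)
  qed
  then show ?thesis by (auto simp: \<alpha>_def)
qed

section \<open>Factors\<close>

text \<open>Convexity at the three points 0, \<open>\<nu>\<close>, \<open>2 * \<nu>\<close> of a
  ray. This much suffices for factors, and it passes to products without a need to expand them as
  expressions.\<close>

definition mid_convex :: "('n \<Rightarrow> real) \<Rightarrow> (('n \<Rightarrow> elt) \<Rightarrow> elt) \<Rightarrow> bool" where
  "mid_convex \<alpha> h \<longleftrightarrow> (\<forall>\<nu>. 2 * tval (h (pt \<alpha> (\<lambda>i. 1) \<nu>)) \<le>
     tval (h (pt \<alpha> (\<lambda>i. 1) (\<lambda>i. 0))) + tval (h (pt \<alpha> (\<lambda>i. 1) (\<lambda>i. 2 * \<nu> i))))"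

lemma mid_convex_elt_poly:
  assumes "is_elt_poly h" shows "mid_convex \<alpha> h"
proof -
  obtain G c where G: "finite G" "G \<noteq> {}" "h = elt_poly G c"
    using assms by (auto simp: is_elt_poly_def)
  show ?thesis unfolding mid_convex_def G(3) elt_poly_trop[OF G(1,2)] elt.sel
  proof
    fix \<nu>
    obtain I where I: "I \<in> G" "tval (c I) + dotp I \<alpha> + dotp I \<nu> = trop G c \<alpha> \<nu>"
      using trop_attained[OF G(1,2)] by blast
    show "2 * trop G c \<alpha> \<nu> \<le> trop G c \<alpha> (\<lambda>i. 0) + trop G c \<alpha> (\<lambda>i. 2 * \<nu> i)"
      using trop_ge[OF G(1) I(1), of c \<alpha> "\<lambda>i. 0"] trop_ge[OF G(1) I(1), of c \<alpha> "\<lambda>i. 2 * \<nu> i"] I(2)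
      by (simp add: dotp_simps)
  qed
qed

lemma mid_convex_mult: "mid_convex \<alpha> g \<Longrightarrow> mid_convex \<alpha> h \<Longrightarrow> mid_convex \<alpha> (\<lambda>x. g x * h x)"
  unfolding mid_convex_def by (simp add: algebra_simps add_mono) (smt (verit))

lemma mid_convex_const: "mid_convex \<alpha> (\<lambda>x. k)"
  by (simp add: mid_convex_def)

lemma mid_convex_prod_mset:
  "(\<And>p. p \<in># P \<Longrightarrow> mid_convex \<alpha> p) \<Longrightarrow> mid_convex \<alpha> (\<lambda>x. \<Prod>p\<in>#P. p x)"
  by (induction P) (auto intro: mid_convex_const mid_convex_mult)

text \<open>The tangible value of \<open>f\<close> is affine along rays from \<open>\<alpha>\<close>. Being convex, so are those of its
  factors, hence only monomials that are maximal at \<open>\<alpha>\<close> are ever maximal.\<close>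

lemma symbol_factor:
  assumes f: "symbol \<alpha> l b f" and g: "is_elt_poly g" and h: "mid_convex \<alpha> h"
    and fgh: "\<And>x. f x = g x * h x"
  shows "\<exists>m d. symbol \<alpha> m d g"
proof -
  note fin = symbol_finite[OF f]
  obtain G c where G: "finite G" "G \<noteq> {}" "g = elt_poly G c"
    using g by (auto simp: is_elt_poly_def)
  define d where "d = trop G c \<alpha> (\<lambda>i. 0)"
  have tv: "b + maxdot l \<nu> = trop G c \<alpha> \<nu> + tval (h (pt \<alpha> (\<lambda>i. 1) \<nu>))" for \<nu>
    using arg_cong[OF fgh[of "pt \<alpha> (\<lambda>i. 1) \<nu>"], of tval]
    unfolding symbol_pt[OF f] G(3) elt_poly_trop[OF G(1,2)] by simp
  \<comment> \<open>Since \<open>maxdot l\<close> is linear along the ray, the convexity inequality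
    of the cofactor becomes the reverse inequality for \<open>g\<close>.\<close>
  have mid: "d + trop G c \<alpha> (\<lambda>i. 2 * \<nu> i) \<le> 2 * trop G c \<alpha> \<nu>" for \<nu>
  proof -
    have "maxdot l (\<lambda>i. 2 * \<nu> i) = 2 * maxdot l \<nu>" "maxdot l (\<lambda>i. 0) = 0"
      using fin by (auto simp: maxdot_scale maxdot_0)
    then show ?thesis
      using h[unfolded mid_convex_def, rule_format, of \<nu>] tv[of \<nu>] tv[of "\<lambda>i. 0"] tv[of "\<lambda>i. 2 * \<nu> i"]
      unfolding d_def by linarith
  qed
  have "\<exists>m. symbol \<alpha> m d (elt_poly G c)"
  proof (rule symbol_elt_poly[OF G(1,2)])
    fix \<nu>
    show "\<exists>I\<in>G. tval (c I) + dotp I \<alpha> + dotp I \<nu> = trop G c \<alpha> \<nu> \<and> layer (c I) \<noteq> 0"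
    proof (rule ccontr)
      \<comment> \<open>Then \<open>g\<close>, and with it \<open>f\<close>, has layer 0 at
        displacement \<open>\<nu>\<close> for all layers of the point, although the initial form of
        \<open>l\<close> is a nonzero polynomial.\<close>
      assume "\<not> ?thesis"
      then have "layer (g (pt \<alpha> \<xi> \<nu>)) = 0" for \<xi>
        unfolding G(3) elt_poly_trop[OF G(1,2)] by (auto intro!: sum.neutral)
      then have "layer (f (pt \<alpha> \<xi> \<nu>)) = 0" for \<xi> by (simp add: fgh)
      then have z: "ev \<xi> (init_form l \<nu>) = 0" for \<xi> :: "'a \<Rightarrow> rat" by (simp add: symbol_pt[OF f])
      have "init_form l \<nu> I = 0" for I
        by (rule ev_rat_eq_0[OF _ z]) (use fin(1) in \<open>simp add: supp_init_form\<close>)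
      then show False using init_form_nonempty[OF fin] by (auto simp: supp_def)
    qed
    fix I assume I: "I \<in> G" "tval (c I) + dotp I \<alpha> + dotp I \<nu> = trop G c \<alpha> \<nu>"
    \<comment> \<open>The value of \<open>I\<close> is affine along the ray, at most
      \<open>trop\<close> at 0 and \<open>2 * \<nu>\<close>, and equal to \<open>trop\<close> at
      \<open>\<nu>\<close>; \<open>mid\<close> then forces equality at 0.\<close>
    show "tval (c I) + dotp I \<alpha> = d"
      using trop_ge[OF G(1) I(1), of c \<alpha> "\<lambda>i. 0"] trop_ge[OF G(1) I(1), of c \<alpha> "\<lambda>i. 2 * \<nu> i"]
        I(2) mid[of \<nu>] unfolding d_def dotp_simps by linarith
  qed
  then show ?thesis using G(3) by blast
qed

section \<open>Unique factorization\<close>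

lemma symbol_ev_nonzero:
  assumes "alg_indep \<theta> UNIV" "symbol \<alpha> l b f"
  shows "ev \<theta> l \<noteq> 0"
proof
  assume "ev \<theta> l = 0"
  then have "l I = 0" for I using alg_indepD[OF assms(1) symbol_finite(1)[OF assms(2)]] by blast
  then show False using symbol_finite(2)[OF assms(2)] by (simp add: supp_def)
qed

lemma ev_range_UNIV: "ev_range \<theta> UNIV = {ev \<theta> l |l. finite (supp l)}"
  by (auto simp: ev_range_def)

lemma ev_range_symbol:
  assumes "u \<in> ev_range \<theta> UNIV" "u \<noteq> 0"
  shows "\<exists>l f. symbol \<alpha> l b f \<and> u = ev \<theta> l"
proof -
  obtain l where l: "finite (supp l)" "u = ev \<theta> l" using assms(1) by (auto simp: ev_range_UNIV)
  then have "supp l \<noteq> {}" using assms(2) by (auto simp: ev_def)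
  then show ?thesis using symbol_exists[OF l(1)] l(2) by blast
qed

lemma symbol_in_ev_range: "symbol \<alpha> l b f \<Longrightarrow> ev \<theta> l \<in> ev_range \<theta> UNIV"
  unfolding ev_range_UNIV using symbol_finite(1) by blast

text \<open>The number \<open>ev \<theta> l\<close> determines the layers only, so the tangible
  values \<open>b\<close> and \<open>d\<close> come back as the shift \<open>b - d\<close> of the
  constant.\<close>

lemma symbol_eqI:
  assumes \<theta>: "alg_indep \<theta> UNIV" and f: "symbol \<alpha> l b f" and g: "symbol \<alpha> m d g"
    and r: "ev \<theta> l = of_rat r * ev \<theta> m"
  shows "f = (\<lambda>x. Elt r (b - d) * g x)" "r \<noteq> 0"
proof -
  show "r \<noteq> 0" using symbol_ev_nonzero[OF \<theta> f] r by auto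
  note s = supp_scale[OF this, of m]
  have "l = (\<lambda>I. r * m I)"
    using symbol_finite[OF f] symbol_finite[OF g] s r
    by (intro alg_indep_eq[OF \<theta>]) (auto simp: ev_scale)
  then show "f = (\<lambda>x. Elt r (b - d) * g x)"
    using symbol_scale[OF g \<open>r \<noteq> 0\<close>, of "b - d"] f by (auto intro: symbol_fun_eq)
qed

lemma Rats_unit_in_ev_range:
  assumes "u \<in> \<rat>" "u \<noteq> 0"
  shows "unit_in (ev_range \<theta> UNIV) u"
proof -
  have Q: "\<rat> \<subseteq> ev_range \<theta> UNIV"
  proof
    fix a :: real assume "a \<in> \<rat>"
    then obtain r where r: "a = of_rat r" by (auto elim: Rats_cases)
    have "finite (supp (\<lambda>J. if J = (\<lambda>i. 0) then r else 0))"
      by (rule finite_subset[of _ "{\<lambda>i. 0}"]) (auto simp: supp_def)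
    then show "a \<in> ev_range \<theta> UNIV" unfolding ev_range_UNIV mem_Collect_eq r
      by (intro exI[of _ "\<lambda>J. if J = (\<lambda>i. 0) then r else 0"]) (simp only: ev_single mon_0 mult_1_right)
  qed
  have "1 = u * inverse u" "inverse u \<in> \<rat>" using assms by auto
  then show ?thesis using Q assms(1) unfolding unit_in_def dvd_in_def by blast
qed

text \<open>Forwards, a prime divisor \<open>q\<close> of \<open>ev \<theta> l\<close> yields a
  factorization of \<open>p\<close>, and irreducibility makes the cofactor a unit. Backwards,
  factors of \<open>p\<close> have symbols by \<open>symbol_factor\<close>; the prime divides one of
  them, so the other is a unit and its function constant.\<close>

lemma irreducible_iff_prime:
  assumes \<theta>: "alg_indep \<theta> UNIV" and U: "factorial_subring (ev_range \<theta> UNIV)"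
    and units: "\<And>u. unit_in (ev_range \<theta> UNIV) u \<Longrightarrow> u \<in> \<rat>"
    and p: "symbol \<alpha> l b p"
  shows "elt_irreducible p \<longleftrightarrow> prime_in (ev_range \<theta> UNIV) (ev \<theta> l)"
proof
  let ?U = "ev_range \<theta> UNIV"
  have R: "is_subring ?U" using U by (simp add: factorial_subring_def)
  let ?u = "ev \<theta> l"
  have u: "?u \<in> ?U" "?u \<noteq> 0" using symbol_in_ev_range[OF p] symbol_ev_nonzero[OF \<theta> p] by auto
  note const = symbol_constant_iff[OF \<theta>]
  {
    assume irr: "elt_irreducible p"
    then have nc: "?u \<notin> \<rat>" using const[OF p] by (auto simp: elt_irreducible_def)
    have "prime_product ?U ?u" using U u by (auto simp: factorial_subring_def)
    then show "prime_in ?U ?u"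
    proof cases
      case unit
      then show ?thesis using units nc by blast
    next
      case (prime q w)
      have q: "q \<in> ?U" "q \<noteq> 0" "\<not> unit_in ?U q" using prime(2) prime_inD by blast+
      have w: "w \<in> ?U" "w \<noteq> 0" using prime_product_in[OF R prime(3)] u prime(1) by auto
      \<comment> \<open>The tangible value \<open>b\<close> of \<open>p\<close> goes entirely to
        \<open>fq\<close> and 0 to \<open>fw\<close>, so that the constant between \<open>p\<close>
        and the product becomes 1.\<close>
      obtain lq fq where fq: "symbol \<alpha> lq b fq" "q = ev \<theta> lq" using ev_range_symbol[OF q(1,2)] by blast
      obtain lw fw where fw: "symbol \<alpha> lw 0 fw" "w = ev \<theta> lw" using ev_range_symbol[OF w] by blast
      note m = symbol_mult[OF fq(1) fw(1)]
      have "?u = of_rat 1 * ev \<theta> (conv lq lw)"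
        using prime(1) fq(2) fw(2) symbol_finite(1)[OF fq(1)] symbol_finite(1)[OF fw(1)]
        by (simp add: ev_conv)
      then have "p = (\<lambda>x. Elt 1 (b - (b + 0)) * (fq x * fw x))" by (rule symbol_eqI(1)[OF \<theta> p m])
      then have "\<forall>x. p x = fq x * fw x" by (simp add: times_elt_def)
      then have "constant_fun fq \<or> constant_fun fw"
        using irr fq(1) fw(1) symbol_is_elt_poly unfolding elt_irreducible_def by blast
      moreover have "q \<notin> \<rat>" using q Rats_unit_in_ev_range by blast
      ultimately have "w \<in> \<rat>" using const[OF fq(1)] const[OF fw(1)] fq fw by simp
      then have "unit_in ?U w" using Rats_unit_in_ev_range w by blast
      then show ?thesis using prime_in_unit_mult[OF R prime(2)] prime(1) by (metis mult.commute)
    qed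
  next
    assume prime: "prime_in ?U ?u"
    have split: "constant_fun h" if gh: "symbol \<alpha> l1 b1 g" "symbol \<alpha> l2 b2 h"
      "?u = ev \<theta> l1 * ev \<theta> l2" and d: "dvd_in ?U ?u (ev \<theta> l1)" for g h l1 l2 b1 b2
    proof -
      obtain z where z: "z \<in> ?U" "ev \<theta> l1 = ?u * z" using d by (auto simp: dvd_in_def)
      have "?u * 1 = ?u * (ev \<theta> l2 * z)" using gh(3) z(2) by (simp add: mult_ac)
      then have "1 = ev \<theta> l2 * z" using u(2) mult_cancel_left by blast
      then have "unit_in ?U (ev \<theta> l2)"
        using symbol_in_ev_range[OF gh(2)] z(1) unfolding unit_in_def dvd_in_def by blast
      then show ?thesis using units const[OF gh(2)] by blast
    qed
    have "\<not> constant_fun p"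
      using const[OF p] prime u Rats_unit_in_ev_range prime_inD by blast
    moreover have "constant_fun g \<or> constant_fun h"
      if g: "is_elt_poly g" and h: "is_elt_poly h" and pgh: "\<And>x. p x = g x * h x" for g h
    proof -
      obtain l1 b1 where l1: "symbol \<alpha> l1 b1 g"
        using symbol_factor[OF p g mid_convex_elt_poly[OF h] pgh] by blast
      obtain l2 b2 where l2: "symbol \<alpha> l2 b2 h"
        using symbol_factor[OF p h mid_convex_elt_poly[OF g]] pgh by (metis mult.commute)
      have "p = (\<lambda>x. g x * h x)" using pgh by auto
      then have "l = conv l1 l2" using symbol_unique(1)[OF p] symbol_mult[OF l1 l2] by simp
      then have e: "?u = ev \<theta> l1 * ev \<theta> l2"
        using symbol_finite[OF l1] symbol_finite[OF l2] by (simp add: ev_conv)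
      have "dvd_in ?U ?u (ev \<theta> l1 * ev \<theta> l2)"
        unfolding e[symmetric] dvd_in_def using is_subringD(2)[OF R] by force
      then have "dvd_in ?U ?u (ev \<theta> l1) \<or> dvd_in ?U ?u (ev \<theta> l2)"
        using prime_inD(4)[OF prime] symbol_in_ev_range l1 l2 by blast
      then show ?thesis
        using split[OF l1 l2 e] split[OF l2 l1] e by (auto simp: mult.commute)
    qed
    ultimately show "elt_irreducible p"
      unfolding elt_irreducible_def using symbol_is_elt_poly[OF p] by blast
  }
qed

lemma symbol_prod_mset:
  assumes "\<And>p. p \<in># P \<Longrightarrow> \<exists>b. symbol \<alpha> (L p) b p"
  shows "\<exists>l b. symbol \<alpha> l b (\<lambda>x. \<Prod>p\<in>#P. p x) \<and> ev \<theta> l = (\<Prod>p\<in>#P. ev \<theta> (L p))"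
  using assms
proof (induction P)
  case empty
  have "symbol \<alpha> (\<lambda>J. if J = (\<lambda>i. 0) then 1 else 0) 0 (\<lambda>x. Elt 1 0)" by (rule symbol_const) simp
  then show ?case
    by (intro exI[of _ "\<lambda>J. if J = (\<lambda>i. 0) then 1 else 0"] exI[of _ 0])
      (simp only: ev_single mon_0 of_rat_1 image_mset_empty prod_mset_empty one_elt_def mult_1_right)
next
  case (add p P)
  then obtain l b where l: "symbol \<alpha> l b (\<lambda>x. \<Prod>p\<in>#P. p x)" "ev \<theta> l = (\<Prod>p\<in>#P. ev \<theta> (L p))"
    by (metis union_single_eq_member insert_iff set_mset_add_mset_insert)
  obtain d where d: "symbol \<alpha> (L p) d p" using add.prems by auto
  show ?case using symbol_mult[OF d l(1)] symbol_finite[OF d] symbol_finite[OF l(1)] l(2)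
    by (intro exI[of _ "conv (L p) l"] exI[of _ "d + b"]) (simp add: ev_conv)
qed

text \<open>The cofactor of \<open>p\<close>, which includes \<open>k\<close>, enters
  \<open>symbol_factor\<close> through its midpoint convexity alone, inherited from constants and
  polynomials.\<close>

lemma factorization_symbols:
  assumes f: "symbol \<alpha> l b f" and fac: "irreducible_factorization f k P" and p: "p \<in># P"
  shows "\<exists>m d. symbol \<alpha> m d p"
proof (rule symbol_factor[OF f])
  have irr: "\<And>q. q \<in># P \<Longrightarrow> is_elt_poly q"
    using fac by (auto simp: irreducible_factorization_def elt_irreducible_def)
  then show "is_elt_poly p" using p by blast
  have P: "P = add_mset p (P - {#p#})" using p by simp
  show "mid_convex \<alpha> (\<lambda>x. k * (\<Prod>q\<in>#P - {#p#}. q x))"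
    using irr by (intro mid_convex_mult mid_convex_const mid_convex_prod_mset mid_convex_elt_poly)
      (auto dest: in_diffD)
  fix x
  have "f x = k * (\<Prod>q\<in>#add_mset p (P - {#p#}). q x)"
    using fac P by (simp add: irreducible_factorization_def)
  then show "f x = p x * (k * (\<Prod>q\<in>#P - {#p#}. q x))" by (simp add: mult_ac)
qed

text \<open>Otherwise all layers of \<open>f\<close> would vanish, among them those at
  \<open>\<alpha>\<close>, which are the values of the nonzero polynomial \<open>l\<close>. Hence
  the constant of a factorization corresponds to a unit.\<close>

lemma symbol_layer_nonzero:
  assumes "symbol \<alpha> l b f" "\<And>x. f x = k * g x"
  shows "layer k \<noteq> 0"
proof
  assume "layer k = 0"
  then have z: "ev \<xi> l = 0" for \<xi> :: "'a \<Rightarrow> rat"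
    using assms(2)[of "pt \<alpha> \<xi> (\<lambda>i. 0)"] symbol_finite[OF assms(1)]
    by (simp add: symbol_pt[OF assms(1)] init_form_0 times_elt_def)
  have "l I = 0" for I by (rule ev_rat_eq_0[OF _ z]) (rule symbol_finite[OF assms(1)])
  then show False using symbol_finite[OF assms(1)] by (auto simp: supp_def)
qed

lemma symbol_factors_uniquely:
  fixes \<alpha> :: "'n::finite \<Rightarrow> real"
  assumes f: "symbol \<alpha> l b f"
  shows "factors_uniquely f"
proof -
  obtain \<theta> :: "'n \<Rightarrow> real" where \<theta>: "alg_indep \<theta> UNIV" and U: "factorial_subring (ev_range \<theta> UNIV)"
    and units: "\<And>u. unit_in (ev_range \<theta> UNIV) u \<Longrightarrow> u \<in> \<rat>"
    using ex_alg_indep[of "UNIV :: 'n set"] by auto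
  let ?U = "ev_range \<theta> UNIV"
  have R: "is_subring ?U" using U by (simp add: factorial_subring_def)
  note irr_iff = irreducible_iff_prime[OF \<theta> U units]
  \<comment> \<open>By \<open>symbol_unique\<close> the choice is forced for every function that has
    a symbol.\<close>
  define L where "L p = (SOME l. \<exists>b. symbol \<alpha> l b p)" for p
  have L: "\<exists>b. symbol \<alpha> (L p) b p" if "symbol \<alpha> m d p" for p m d
    unfolding L_def using someI_ex[of "\<lambda>l. \<exists>b. symbol \<alpha> l b p"] that by blast
  define \<phi> where "\<phi> = (\<lambda>p. ev \<theta> (L p))"
  have "\<exists>k P. irreducible_factorization f k P"
  proof -
    have "prime_product ?U (ev \<theta> l)"
      using U symbol_in_ev_range[OF f] symbol_ev_nonzero[OF \<theta> f] by (auto simp: factorial_subring_def)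
    then obtain e M where e: "unit_in ?U e" and M: "\<And>q. q \<in># M \<Longrightarrow> prime_in ?U q"
        and eM: "ev \<theta> l = e * prod_mset M"
      by (metis prime_product_mset)
    obtain r where r: "e = of_rat r" using units[OF e] by (auto elim: Rats_cases)
    have "\<exists>p. (\<exists>d. symbol \<alpha> (L p) d p) \<and> \<phi> p = q" if q: "prime_in ?U q" for q
    proof -
      obtain m p where m: "symbol \<alpha> m 0 p" "q = ev \<theta> m"
        using ev_range_symbol[OF prime_inD(1,2)[OF q]] by blast
      obtain d where d: "symbol \<alpha> (L p) d p" using L[OF m(1)] by blast
      then have "\<phi> p = q" unfolding \<phi>_def using symbol_unique(1)[OF d m(1)] m(2) by simp
      then show ?thesis using d by blast
    qed
    \<comment> \<open>Fixing one function per prime lets \<open>image_mset\<close> lift the multiset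
      \<open>M\<close> with its multiplicities.\<close>
    then obtain p where p: "\<And>q. prime_in ?U q \<Longrightarrow> (\<exists>d. symbol \<alpha> (L (p q)) d (p q)) \<and> \<phi> (p q) = q"
      by metis
    define P where "P = image_mset p M"
    have PL: "\<exists>d. symbol \<alpha> (L x) d x" if "x \<in># P" for x using that p M by (auto simp: P_def)
    obtain m d where m: "symbol \<alpha> m d (\<lambda>x. \<Prod>p\<in>#P. p x)" "ev \<theta> m = (\<Prod>p\<in>#P. ev \<theta> (L p))"
      using symbol_prod_mset[OF PL] by blast
    have "image_mset (\<lambda>q. \<phi> (p q)) M = image_mset (\<lambda>q. q) M"
      using p M by (intro image_mset_cong) auto
    then have "ev \<theta> m = prod_mset M"
      unfolding m(2) P_def by (simp add: \<phi>_def image_mset.compositionality comp_def)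
    then have "f = (\<lambda>x. Elt r (b - d) * (\<Prod>p\<in>#P. p x))"
      using symbol_eqI(1)[OF \<theta> f m(1)] eM r by simp
    moreover have "elt_irreducible x" if "x \<in># P" for x
    proof -
      obtain q where q: "q \<in># M" "x = p q" using \<open>x \<in># P\<close> by (auto simp: P_def)
      obtain d where "symbol \<alpha> (L x) d x" using PL \<open>x \<in># P\<close> by blast
      then show ?thesis using irr_iff p[OF M[OF q(1)]] M[OF q(1)] q(2) by (simp add: \<phi>_def)
    qed
    ultimately have "irreducible_factorization f (Elt r (b - d)) P"
      by (simp add: irreducible_factorization_def)
    then show ?thesis by blast
  qed
  moreover have "rel_mset equal_up_to_constant P Q"
    if P: "irreducible_factorization f k P" and Q: "irreducible_factorization f k' Q" for k k' P Q
  proof -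
    \<comment> \<open>Any factorization of \<open>f\<close>, whatever its constant, becomes a prime
      factorization of the same element \<open>ev \<theta> l\<close>, so two of them can be
      compared.\<close>
    have main: "(\<forall>p. p \<in># P \<longrightarrow> (\<exists>d. symbol \<alpha> (L p) d p) \<and> prime_in ?U (\<phi> p)) \<and>
        (\<exists>e. unit_in ?U e \<and> ev \<theta> l = e * prod_mset (image_mset \<phi> P))"
      if P: "irreducible_factorization f k P" for k P
    proof -
      have PL: "\<exists>d. symbol \<alpha> (L p) d p" if "p \<in># P" for p
        using factorization_symbols[OF f P that] L by blast
      moreover have "prime_in ?U (\<phi> p)" if "p \<in># P" for p
        using PL[OF that] irr_iff P that unfolding irreducible_factorization_def \<phi>_def by blast
      moreover obtain m d where m: "symbol \<alpha> m d (\<lambda>x. \<Prod>p\<in>#P. p x)" "ev \<theta> m = (\<Prod>p\<in>#P. ev \<theta> (L p))"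
        using symbol_prod_mset[OF PL] by blast
      have fk: "\<And>x. f x = k * (\<Prod>p\<in>#P. p x)" using P by (simp add: irreducible_factorization_def)
      have k0: "layer k \<noteq> 0" using symbol_layer_nonzero[OF f fk] .
      have "f = (\<lambda>x. Elt (layer k) (tval k) * (\<Prod>p\<in>#P. p x))" using fk by auto
      then have "symbol \<alpha> (\<lambda>I. layer k * m I) (tval k + d) f"
        using symbol_scale[OF m(1) k0, of "tval k"] by simp
      then have "l = (\<lambda>I. layer k * m I)" using symbol_unique(1)[OF f] by blast
      then have "ev \<theta> l = of_rat (layer k) * prod_mset (image_mset \<phi> P)"
        by (simp add: ev_scale m(2) \<phi>_def)
      moreover have "unit_in ?U (of_rat (layer k))" using k0 by (intro Rats_unit_in_ev_range) auto
      ultimately show ?thesis by blast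
    qed
    obtain e where e: "unit_in ?U e" "ev \<theta> l = e * prod_mset (image_mset \<phi> P)" using main[OF P] by blast
    obtain e' where e': "unit_in ?U e'" "ev \<theta> l = e' * prod_mset (image_mset \<phi> Q)" using main[OF Q] by blast
    have "rel_mset (\<lambda>p q. \<exists>e. unit_in ?U e \<and> p = e * q) (image_mset \<phi> P) (image_mset \<phi> Q)"
      using e e' main[OF P] main[OF Q] by (intro unique_prime_factorization[OF R e(1) e'(1)]) auto
    then have "rel_mset (\<lambda>p q. \<exists>e. unit_in ?U e \<and> \<phi> p = e * \<phi> q) P Q"
      by (simp add: multiset.rel_map)
    then show ?thesis
    proof (rule multiset.rel_mono_strong)
      fix p q assume pq: "p \<in># P" "q \<in># Q" and "\<exists>e. unit_in ?U e \<and> \<phi> p = e * \<phi> q"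
      then obtain e where e: "unit_in ?U e" "\<phi> p = e * \<phi> q" by blast
      obtain r where r: "e = of_rat r" using units[OF e(1)] by (auto elim: Rats_cases)
      obtain d d' where "symbol \<alpha> (L p) d p" "symbol \<alpha> (L q) d' q"
        using main[OF P] main[OF Q] pq by blast
      then have "p = (\<lambda>x. Elt r (d - d') * q x)" "r \<noteq> 0"
        using symbol_eqI[OF \<theta>, of \<alpha> "L p" d p "L q" d' q r] e(2) r by (auto simp: \<phi>_def)
      then show "equal_up_to_constant p q"
        unfolding equal_up_to_constant_def by (intro exI[of _ "Elt r (d - d')"]) auto
    qed
  qed
  ultimately show ?thesis unfolding factors_uniquely_def by blast
qed

theorem theorem6p1:
  fixes G :: "('n::finite \<Rightarrow> nat) set"
    and c :: "('n \<Rightarrow> nat) \<Rightarrow> elt"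
    and f :: "('n \<Rightarrow> elt) \<Rightarrow> elt"
    and a :: "'n \<Rightarrow> elt"
  assumes "finite G" and "G \<noteq> {}" and "f = elt_poly G c"
    and "regular G c"
    and "\<forall>i. tangible (a i)"
    and "primary_at G c a"
  shows "factors_uniquely f"
  using regular_primary_symbol[OF assms(1,2,4,6)] symbol_factors_uniquely assms(3) by blast

end
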